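(* Let $p$ be an odd prime. Then $$C_{\rm sd}(p^2)-C_{\rm su}(p^2)-C_{\rm t}(p^2)=C_{\rm sd}(p)^2-C_{\rm su}(p)^2-C_{\rm t}(p)^2.$$
   Context: All graphs are simple (no loops, no multiple edges or arcs). An undirected edge is identified with the pair of oppositely directed arcs, so undirected graphs are regarded as symmetric digraphs. A circulant of order $n$ is a digraph on the vertex set $\mathbb{Z}_n=\{0,1,\dots,n-1\}$ invariant under the cyclic permutation $v\mapsto v+1 \pmod n$. A digraph is a tournament if for every two distinct vertices $u,v$ exactly one of the arcs $(u,v),(v,u)$ is present. The complement of a digraph has the same vertices and, for distinct $u,v$, the arc $(u,v)$ exactly when the original does not; a digraph is self-complementary if it is isomorphic to its complement. $C_{\rm sd}(n)$, $C_{\rm su}(n)$, $C_{\rm t}(n)$ are the numbers of isomorphism classes of, respectively, self-complementary directed circulants (symmetric ones and tournaments included), self-complementary undirected circulants, and circulant tournaments of order $n$. *)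

theory Defs
  imports
    "HOL-Computational_Algebra.Primes"
    "Graph_Theory.Pair_Digraph"
    "Graph_Theory.Digraph_Isomorphism"
begin

definition compl_digraph :: "'a pair_pre_digraph \<Rightarrow> 'a pair_pre_digraph" where
  "compl_digraph G =
     \<lparr>pverts = pverts G,
      parcs = {(u, v). u \<in> pverts G \<and> v \<in> pverts G \<and> u \<noteq> v \<and> (u, v) \<notin> parcs G}\<rparr>"

definition self_complementary :: "'a pair_pre_digraph \<Rightarrow> bool" where
  "self_complementary G \<longleftrightarrow> digraph_iso (with_proj G) (with_proj (compl_digraph G))"

definition tournament :: "'a pair_pre_digraph \<Rightarrow> bool" where
  "tournament G \<longleftrightarrow> pair_digraph G \<and>
     (\<forall>u\<in>pverts G. \<forall>v\<in>pverts G. u \<noteq> v \<longrightarrow> ((u, v) \<in> parcs G) \<noteq> ((v, u) \<in> parcs G))"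

text \<open>The vertex set \<open>\<int>\<^sub>n\<close> is represented by the residues \<open>{..<n}\<close>;
  \<^const>\<open>pair_digraph\<close> excludes loops, and parallel arcs cannot occur
  because arcs are pairs of vertices.\<close>

definition circulants :: "nat \<Rightarrow> nat pair_pre_digraph set" where
  "circulants n = {G. pair_digraph G \<and> pverts G = {..<n} \<and>
     (\<lambda>(u, v). ((u + 1) mod n, (v + 1) mod n)) ` parcs G = parcs G}"

definition num_iso_classes :: "'a pair_pre_digraph set \<Rightarrow> nat" where
  "num_iso_classes S =
     card (S // {(G, H). G \<in> S \<and> H \<in> S \<and> digraph_iso (with_proj G) (with_proj H)})"

definition C_sd :: "nat \<Rightarrow> nat" where
  "C_sd n = num_iso_classes {G \<in> circulants n. self_complementary G}"

definition C_su :: "nat \<Rightarrow> nat" where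
  "C_su n = num_iso_classes {G \<in> circulants n. self_complementary G \<and> symmetric (with_proj G)}"

definition C_t :: "nat \<Rightarrow> nat" where
  "C_t n = num_iso_classes {G \<in> circulants n. tournament G}"

end

theory Submission
  imports Defs "HOL-Number_Theory.Cong" "HOL-Combinatorics.Permutations"
begin

text \<open>
  Call a circulant of order \<open>p\<^sup>2\<close> uniform if arcs between different residue classes mod \<open>p\<close>
  depend on these classes only.  The self-complementary circulants of order \<open>p\<^sup>2\<close> are counted
  separately according to uniformity, and both parts are invariant under isomorphism.

  The non-uniform part contributes nothing to the left-hand side, because each of its members is
  symmetric or a tournament, and never both.  Let \<open>G\<close> be one of them.  As it is not uniform,
  at most \<open>p - 1\<close> multipliers fix it.  Consider the conjugates \<open>f \<circ> rot \<circ> f\<^sup>-\<^sup>1\<close> of the rotation under automorphisms \<open>f\<close>: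
  conjugation by the rotation, having \<open>p\<close>-power order, fixes between \<open>1\<close> and \<open>p - 1\<close> of them, so
  their number is prime to \<open>p\<close>.  Hence every automorphism of \<open>p\<close>-power order commutes with one of
  them.  Applied to the rotation conjugated by an isomorphism onto the complement, this replaces
  that isomorphism by one of the form \<open>x \<mapsto> m x + c\<close>; so a multiplier \<open>m\<close> carries \<open>G\<close> to its
  complement (\<open>complementing_multiplier\<close>).  The order of \<open>m\<close> modulo \<open>p\<^sup>2\<close> is even, and
  therefore \<open>-1\<close> is a power of \<open>m\<close>; the multiplier \<open>-1\<close> thus fixes \<open>G\<close>, which makes \<open>G\<close>
  symmetric, or complements it, which makes \<open>G\<close> a tournament (\<open>symmetric_or_tournament\<close>).

  The uniform circulants are the wreath products of two circulants of order \<open>p\<close>.  Self-complementarity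
  forces both factors to have valency \<open>(p - 1) / 2\<close>, and then two vertices lie in the same block
  exactly when their out-neighbourhoods differ in fewer than \<open>p\<close> vertices
  (\<open>nbr_diff_wreath_less_iff\<close>).  Isomorphisms therefore respect the blocks, so that the isomorphism
  classes of both factors are determined by the class of the product (\<open>wreath_isomorphicD\<close>).  The
  properties of being self-complementary, symmetric or a tournament hold for the product if and
  only if they hold for both factors.  Hence the uniform part of each of the three numbers for
  \<open>p\<^sup>2\<close> is the square of the corresponding number for \<open>p\<close> (\<open>num_classes_uniform_split\<close>),
  which gives the right-hand side.
\<close>

section \<open>Isomorphisms and isomorphism classes\<close>

text \<open>Isomorphism of digraphs without parallel arcs needs a vertex map only; in contrast to
  \<^const>\<open>digraph_iso\<close>, this gives an equivalence relation without any well-formedness condition.\<close>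

definition isom :: "('a \<Rightarrow> 'b) \<Rightarrow> 'a pair_pre_digraph \<Rightarrow> 'b pair_pre_digraph \<Rightarrow> bool" where
  "isom f G H \<longleftrightarrow> bij_betw f (pverts G) (pverts H) \<and>
     (\<forall>u\<in>pverts G. \<forall>v\<in>pverts G. (u, v) \<in> parcs G \<longleftrightarrow> (f u, f v) \<in> parcs H)"

definition isomorphic :: "'a pair_pre_digraph \<Rightarrow> 'b pair_pre_digraph \<Rightarrow> bool" where
  "isomorphic G H \<longleftrightarrow> (\<exists>f. isom f G H)"

lemma isom_id: "isom id G G"
  by (auto simp: isom_def)

lemma isom_comp: "isom f G H \<Longrightarrow> isom g H K \<Longrightarrow> isom (g \<circ> f) G K"
  unfolding isom_def by (auto intro: bij_betw_trans dest: bij_betwE)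

lemma isom_inv_into:
  assumes "isom f G H" shows "isom (inv_into (pverts G) f) H G"
proof -
  have b: "bij_betw f (pverts G) (pverts H)" using assms by (simp add: isom_def)
  have b': "bij_betw (inv_into (pverts G) f) (pverts H) (pverts G)"
    using b by (rule bij_betw_inv_into)
  show ?thesis
    unfolding isom_def
  proof (intro conjI ballI b')
    fix u v assume uv: "u \<in> pverts H" "v \<in> pverts H"
    let ?u = "inv_into (pverts G) f u" and ?v = "inv_into (pverts G) f v"
    have "?u \<in> pverts G" "?v \<in> pverts G" "f ?u = u" "f ?v = v"
      using b b' uv by (auto dest: bij_betwE simp: bij_betw_inv_into_right)
    then show "(u, v) \<in> parcs H \<longleftrightarrow> (?u, ?v) \<in> parcs G"
      using assms unfolding isom_def by metis
  qed
qed

lemma isomorphic_refl: "isomorphic G G"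
  unfolding isomorphic_def using isom_id by blast

lemma isomorphic_sym: "isomorphic G H \<Longrightarrow> isomorphic H G"
  unfolding isomorphic_def using isom_inv_into by blast

lemma isomorphic_trans: "isomorphic G H \<Longrightarrow> isomorphic H K \<Longrightarrow> isomorphic G K"
  unfolding isomorphic_def using isom_comp by blast

lemma digraph_iso_iff_isomorphic:
  assumes "pair_wf_digraph G" "pair_wf_digraph H"
  shows "digraph_iso (with_proj G) (with_proj H) \<longleftrightarrow> isomorphic G H"
proof
  assume "digraph_iso (with_proj G) (with_proj H)"
  then obtain h where h: "pre_digraph.digraph_isomorphism (with_proj G) h"
    and H: "with_proj H = app_iso h (with_proj G)"
    unfolding digraph_iso_def by blast
  have vH: "pverts H = iso_verts h ` pverts G"
    and aH: "parcs H = iso_arcs h ` parcs G"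
    and tl: "iso_tail h = fst" and hd: "iso_head h = snd"
    using arg_cong[OF H, of verts] arg_cong[OF H, of arcs]
      arg_cong[OF H, of tail] arg_cong[OF H, of head] by simp_all
  have inj: "inj_on (iso_verts h) (pverts G)"
    and ends: "\<And>a. a \<in> parcs G \<Longrightarrow> iso_arcs h a = (iso_verts h (fst a), iso_verts h (snd a))"
    using h unfolding pre_digraph.digraph_isomorphism_def by (auto simp: tl hd prod_eq_iff)
  have "isom (iso_verts h) G H"
    unfolding isom_def
  proof (intro conjI ballI)
    show "bij_betw (iso_verts h) (pverts G) (pverts H)" using inj vH by (simp add: bij_betw_def)
    fix u v assume uv: "u \<in> pverts G" "v \<in> pverts G"
    show "(u, v) \<in> parcs G \<longleftrightarrow> (iso_verts h u, iso_verts h v) \<in> parcs H"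
    proof
      assume "(u, v) \<in> parcs G"
      then show "(iso_verts h u, iso_verts h v) \<in> parcs H" using ends aH by force
    next
      assume "(iso_verts h u, iso_verts h v) \<in> parcs H"
      then obtain a b where ab: "(a, b) \<in> parcs G"
        and "iso_arcs h (a, b) = (iso_verts h u, iso_verts h v)"
        unfolding aH by force
      then have e: "iso_verts h a = iso_verts h u" "iso_verts h b = iso_verts h v"
        using ends by force+
      have "a \<in> pverts G" "b \<in> pverts G"
        using ab pair_wf_digraph.in_arcsD1[OF assms(1)] pair_wf_digraph.in_arcsD2[OF assms(1)]
        by auto
      then show "(u, v) \<in> parcs G" using ab e uv inj by (auto dest: inj_onD)
    qed
  qed
  then show "isomorphic G H" unfolding isomorphic_def by blast
next
  assume "isomorphic G H"
  then obtain f where f: "bij_betw f (pverts G) (pverts H)"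
    and arc: "\<And>u v. u \<in> pverts G \<Longrightarrow> v \<in> pverts G \<Longrightarrow> (u, v) \<in> parcs G \<longleftrightarrow> (f u, f v) \<in> parcs H"
    unfolding isomorphic_def isom_def by blast
  define h :: "('a, 'a \<times> 'a, 'b, 'b \<times> 'b) digraph_isomorphism" where
    "h = \<lparr>iso_verts = f, iso_arcs = map_prod f f, iso_head = snd, iso_tail = fst\<rparr>"
  note wfG = pair_wf_digraph.in_arcsD1[OF assms(1)] pair_wf_digraph.in_arcsD2[OF assms(1)]
  note wfH = pair_wf_digraph.in_arcsD1[OF assms(2)] pair_wf_digraph.in_arcsD2[OF assms(2)]
  have inj: "inj_on f (pverts G)" and im: "f ` pverts G = pverts H"
    using f by (auto simp: bij_betw_def)
  have "pre_digraph.digraph_isomorphism (with_proj G) h"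
    unfolding pre_digraph.digraph_isomorphism_def h_def
    using assms(1) inj wfG
    by (auto simp: wf_digraph_wp_iff inj_on_def)
  moreover have "map_prod f f ` parcs G = parcs H"
  proof
    show "map_prod f f ` parcs G \<subseteq> parcs H"
    proof
      fix e assume "e \<in> map_prod f f ` parcs G"
      then obtain u v where uv: "(u, v) \<in> parcs G" "e = (f u, f v)" by auto
      then show "e \<in> parcs H" using arc[OF wfG(1)[OF uv(1)] wfG(2)[OF uv(1)]] by simp
    qed
    show "parcs H \<subseteq> map_prod f f ` parcs G"
    proof
      fix e assume e: "e \<in> parcs H"
      then obtain u v where "e = (u, v)" "u \<in> pverts H" "v \<in> pverts H"
        using wfH by (metis prod.exhaust)
      then obtain a b where "e = (f a, f b)" "a \<in> pverts G" "b \<in> pverts G" using im by blast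
      then show "e \<in> map_prod f f ` parcs G" using arc e by force
    qed
  qed
  then have "with_proj H = app_iso h (with_proj G)"
    unfolding app_iso_def h_def with_proj_def using im by simp
  ultimately show "digraph_iso (with_proj G) (with_proj H)" unfolding digraph_iso_def by blast
qed

definition iso_class :: "'a pair_pre_digraph \<Rightarrow> 'a pair_pre_digraph set" where
  "iso_class G = {H. isomorphic G H}"

lemma iso_class_eq_iff: "iso_class G = iso_class H \<longleftrightarrow> isomorphic G H"
  unfolding iso_class_def using isomorphic_refl isomorphic_sym isomorphic_trans by blast

text \<open>Full isomorphism classes, unlike their restrictions to \<open>S\<close>, can be compared across
  different sets \<open>S\<close>; so the count becomes additive and multiplicative by plain cardinality arguments.\<close>

lemma num_iso_classes_eq_card:
  assumes wf: "\<And>G. G \<in> S \<Longrightarrow> pair_wf_digraph G"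
  shows "num_iso_classes S = card (iso_class ` S)"
proof -
  define R where "R = {(G, H). G \<in> S \<and> H \<in> S \<and> digraph_iso (with_proj G) (with_proj H)}"
  have R: "R = {(G, H). G \<in> S \<and> H \<in> S \<and> isomorphic G H}"
    unfolding R_def using digraph_iso_iff_isomorphic wf by blast
  have cls: "R `` {G} = iso_class G \<inter> S" if "G \<in> S" for G
    using that by (auto simp: R iso_class_def)
  have "S // R = (\<lambda>C. C \<inter> S) ` iso_class ` S"
    unfolding quotient_def using cls by auto
  moreover have "inj_on (\<lambda>C. C \<inter> S) (iso_class ` S)"
  proof (rule inj_onI)
    fix C D assume "C \<in> iso_class ` S" "D \<in> iso_class ` S" and eq: "C \<inter> S = D \<inter> S"
    then obtain G H where GH: "G \<in> S" "H \<in> S" "C = iso_class G" "D = iso_class H" by blast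
    have "G \<in> iso_class G" by (simp add: iso_class_def isomorphic_refl)
    then have "isomorphic H G" using GH eq by (auto simp: iso_class_def)
    then show "C = D" using GH iso_class_eq_iff isomorphic_sym by blast
  qed
  ultimately show ?thesis
    unfolding num_iso_classes_def R_def[symmetric] by (simp add: card_image)
qed

lemma isomorphic_symmetric:
  assumes "isomorphic G H" "pair_wf_digraph H" "symmetric (with_proj G)"
  shows "symmetric (with_proj H)"
proof -
  obtain f where f: "isom f H G" using isomorphic_sym[OF assms(1)] unfolding isomorphic_def by blast
  interpret pair_wf_digraph H by fact
  have "(v, u) \<in> parcs H" if "(u, v) \<in> parcs H" for u v
    using f that assms(3) in_arcsD1[OF that] in_arcsD2[OF that]
    unfolding isom_def symmetric_def by (auto dest: symD)
  then show ?thesis by (simp add: symmetric_def sym_def)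
qed

section \<open>Circulants\<close>

text \<open>On a finite vertex set, invariance as an image equation amounts to preservation in both
  directions, since the shift permutes the vertices.\<close>

lemma circulants_iff:
  assumes "n > 0"
  shows "G \<in> circulants n \<longleftrightarrow> pverts G = {..<n} \<and>
     (\<forall>u v. (u, v) \<in> parcs G \<longrightarrow> u < n \<and> v < n \<and> u \<noteq> v) \<and>
     (\<forall>u<n. \<forall>v<n. (u, v) \<in> parcs G \<longleftrightarrow> ((u + 1) mod n, (v + 1) mod n) \<in> parcs G)"
    (is "?L \<longleftrightarrow> ?R")
proof -
  let ?f = "\<lambda>(u, v). ((u + 1) mod n, (v + 1) mod n)"
  have inj1: "(u + 1) mod n = (v + 1) mod n \<Longrightarrow> u = v" if "u < n" "v < n" for u v :: nat
    using that by (metis cong_add_rcancel_nat cong_def mod_less)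
  have surj1: "\<exists>u<n. v = (u + 1) mod n" if "v < n" for v
    using that by (intro exI[of _ "if v = 0 then n - 1 else v - 1"]) auto
  show ?thesis
  proof
    assume L: ?L
    interpret pair_digraph G using L by (simp add: circulants_def)
    have V: "pverts G = {..<n}" and im: "?f ` parcs G = parcs G"
      using L by (auto simp: circulants_def)
    have wf: "\<forall>u v. (u, v) \<in> parcs G \<longrightarrow> u < n \<and> v < n \<and> u \<noteq> v"
      using V in_arcsD1 in_arcsD2 pair_no_loops by fastforce
    have "(u, v) \<in> parcs G" if "u < n" "v < n" "((u + 1) mod n, (v + 1) mod n) \<in> parcs G" for u v
    proof -
      from that(3) have "((u + 1) mod n, (v + 1) mod n) \<in> ?f ` parcs G" unfolding im .
      then obtain a b where ab: "(a, b) \<in> parcs G"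
        "(u + 1) mod n = (a + 1) mod n" "(v + 1) mod n = (b + 1) mod n"
        by auto
      then show ?thesis using inj1 wf that(1,2) by metis
    qed
    moreover have "((u + 1) mod n, (v + 1) mod n) \<in> parcs G" if "(u, v) \<in> parcs G" for u v
      using that im by (metis (mono_tags, lifting) case_prod_conv rev_image_eqI)
    ultimately have sh: "(u, v) \<in> parcs G \<longleftrightarrow> ((u + 1) mod n, (v + 1) mod n) \<in> parcs G"
      if "u < n" "v < n" for u v using that by blast
    show ?R by (intro conjI allI impI V sh) (use wf in auto)
  next
    assume R: ?R
    have V: "pverts G = {..<n}"
      and wf: "\<And>u v. (u, v) \<in> parcs G \<Longrightarrow> u < n \<and> v < n \<and> u \<noteq> v"
      using R[THEN conjunct1] R[THEN conjunct2, THEN conjunct1] by blast+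
    have sh: "((u + 1) mod n, (v + 1) mod n) \<in> parcs G \<longleftrightarrow> (u, v) \<in> parcs G"
      if "u < n" "v < n" for u v
      using R[THEN conjunct2, THEN conjunct2, rule_format, OF that] by (rule sym)
    have sub: "parcs G \<subseteq> {..<n} \<times> {..<n}" using wf by auto
    have "pair_digraph G"
      using V wf finite_subset[OF sub] by unfold_locales auto
    moreover have "?f ` parcs G = parcs G"
    proof
      show "?f ` parcs G \<subseteq> parcs G"
      proof
        fix e assume "e \<in> ?f ` parcs G"
        then obtain a b where "(a, b) \<in> parcs G" "e = ((a + 1) mod n, (b + 1) mod n)" by auto
        then show "e \<in> parcs G" using wf sh by metis
      qed
      show "parcs G \<subseteq> ?f ` parcs G"
      proof
        fix e assume e: "e \<in> parcs G"
        then obtain a b where ab: "e = (a, b)" "a < n" "b < n" using wf by (metis prod.exhaust)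
        obtain u v where uv: "u < n" "v < n" "a = (u + 1) mod n" "b = (v + 1) mod n"
          using surj1 ab by metis
        then have "(u, v) \<in> parcs G" using sh e ab by blast
        then show "e \<in> ?f ` parcs G" using ab uv by (intro image_eqI[of _ _ "(u, v)"]) simp_all
      qed
    qed
    ultimately show ?L using V by (simp add: circulants_def)
  qed
qed

lemma circulant_step:
  assumes "G \<in> circulants n" "u < n" "v < n"
  shows "((u + 1) mod n, (v + 1) mod n) \<in> parcs G \<longleftrightarrow> (u, v) \<in> parcs G"
proof -
  have "n > 0" using assms by simp
  from iffD1[OF circulants_iff[OF this] assms(1), THEN conjunct2, THEN conjunct2, rule_format,
      OF assms(2,3)]
  show ?thesis by (rule sym)
qed

lemma circulant_pverts: "G \<in> circulants n \<Longrightarrow> pverts G = {..<n}"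
  by (simp add: circulants_def)

lemma circulant_digraph: "G \<in> circulants n \<Longrightarrow> pair_digraph G"
  by (simp add: circulants_def)

lemma circulant_wf: "G \<in> circulants n \<Longrightarrow> pair_wf_digraph G"
  by (simp add: circulants_def pair_digraph_def pair_fin_digraph_def)

lemma circulant_arcD:
  assumes "G \<in> circulants n" "(u, v) \<in> parcs G" shows "u < n" "v < n" "u \<noteq> v"
proof -
  interpret pair_digraph G using assms(1) by (rule circulant_digraph)
  show "u < n" "v < n" "u \<noteq> v"
    using assms(2) in_arcsD1 in_arcsD2 pair_no_loops circulant_pverts[OF assms(1)] by fastforce+
qed

lemma finite_circulants: "finite (circulants n)"
proof -
  have "circulants n \<subseteq> (\<lambda>E. \<lparr>pverts = {..<n}, parcs = E\<rparr>) ` Pow ({..<n} \<times> {..<n})"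
  proof
    fix G :: "nat pair_pre_digraph" assume G: "G \<in> circulants n"
    have "parcs G \<subseteq> {..<n} \<times> {..<n}" using circulant_arcD[OF G] by auto
    moreover have "G = \<lparr>pverts = {..<n}, parcs = parcs G\<rparr>"
      using circulant_pverts[OF G] by simp
    ultimately show "G \<in> (\<lambda>E. \<lparr>pverts = {..<n}, parcs = E\<rparr>) ` Pow ({..<n} \<times> {..<n})"
      by blast
  qed
  then show ?thesis by (rule finite_subset) simp
qed

lemma compl_circulant:
  assumes "n > 0" "G \<in> circulants n" shows "compl_digraph G \<in> circulants n"
proof -
  have inj: "(u + 1) mod n = (v + 1) mod n \<longleftrightarrow> u = v" if "u < n" "v < n" for u v :: nat
    using that by (metis cong_add_rcancel_nat cong_def mod_less)
  note V = circulant_pverts[OF assms(2)] and sh = circulant_step[OF assms(2)]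
  have "(u, v) \<in> parcs (compl_digraph G) \<longleftrightarrow> ((u + 1) mod n, (v + 1) mod n) \<in> parcs (compl_digraph G)"
    if uv: "u < n" "v < n" for u v
  proof -
    have "(u + 1) mod n < n" "(v + 1) mod n < n" using assms(1) by simp_all
    then have "(a, b) \<in> parcs (compl_digraph G) \<longleftrightarrow> a \<noteq> b \<and> (a, b) \<notin> parcs G"
      if "(a, b) = (u, v) \<or> (a, b) = ((u + 1) mod n, (v + 1) mod n)" for a b
      using that uv unfolding compl_digraph_def V by auto
    then show ?thesis using sh[OF uv] inj[OF uv] by metis
  qed
  moreover have "\<forall>u v. (u, v) \<in> parcs (compl_digraph G) \<longrightarrow> u < n \<and> v < n \<and> u \<noteq> v"
    unfolding compl_digraph_def V by simp
  moreover have "pverts (compl_digraph G) = {..<n}" by (simp add: compl_digraph_def V)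
  ultimately show ?thesis by (intro iffD2[OF circulants_iff[OF assms(1)]] conjI allI impI) blast+
qed

lemma self_complementary_iff:
  assumes "n > 0" "G \<in> circulants n"
  shows "self_complementary G \<longleftrightarrow> isomorphic G (compl_digraph G)"
  unfolding self_complementary_def
  using digraph_iso_iff_isomorphic[OF circulant_wf[OF assms(2)]
      circulant_wf[OF compl_circulant[OF assms]]] .

text \<open>Adjacency with integer representatives of the residues: translations and multipliers
  become integer arithmetic, and \<open>link n G 0 d\<close> is membership of \<open>d\<close> in the connection set.\<close>

definition link :: "nat \<Rightarrow> nat pair_pre_digraph \<Rightarrow> int \<Rightarrow> int \<Rightarrow> bool" where
  "link n G x y \<longleftrightarrow> (nat (x mod int n), nat (y mod int n)) \<in> parcs G"

lemma link_of_nat: "u < n \<Longrightarrow> v < n \<Longrightarrow> link n G (int u) (int v) \<longleftrightarrow> (u, v) \<in> parcs G"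
  by (simp add: link_def)

lemma link_cong:
  "[x = x'] (mod int n) \<Longrightarrow> [y = y'] (mod int n) \<Longrightarrow> link n G x y = link n G x' y'"
  by (simp add: link_def cong_def)

lemma link_irrefl: "G \<in> circulants n \<Longrightarrow> [x = y] (mod int n) \<Longrightarrow> \<not> link n G x y"
  using circulant_arcD(3) by (auto simp: link_def cong_def)

lemma nat_mod_Suc: "n > 0 \<Longrightarrow> (nat (x mod int n) + 1) mod n = nat ((x + 1) mod int n)"
proof -
  assume n: "n > 0"
  have "int ((nat (x mod int n) + 1) mod n) = (x + 1) mod int n"
    using n by (simp add: zmod_int mod_simps add.commute)
  then show ?thesis by linarith
qed

lemma link_shift:
  assumes "n > 0" "G \<in> circulants n" shows "link n G (x + c) (y + c) = link n G x y"
proof -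
  have step: "link n G (x + 1) (y + 1) = link n G x y" for x y
  proof -
    let ?u = "nat (x mod int n)" and ?v = "nat (y mod int n)"
    have "?u < n" "?v < n" using assms(1) by (simp_all add: nat_less_iff)
    from circulant_step[OF assms(2) this] show ?thesis
      unfolding link_def nat_mod_Suc[OF assms(1)] .
  qed
  have up: "link n G (x + int k) (y + int k) = link n G x y" for x y k
  proof (induction k)
    case (Suc k)
    then show ?case using step[of "x + int k" "y + int k"] by (simp add: algebra_simps)
  qed simp
  show ?thesis
  proof (cases "c \<ge> 0")
    case True then show ?thesis using up[of x "nat c" y] by simp
  next
    case False then show ?thesis using up[of "x + c" "nat (- c)" "y + c"] by simp
  qed
qed

lemma link_diff:
  assumes "n > 0" "G \<in> circulants n" shows "link n G x y = link n G 0 (y - x)"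
  using link_shift[OF assms, of 0 x "y - x"] by simp

lemma circulant_arc_iff:
  assumes "G \<in> circulants n" "u < n" "v < n"
  shows "(u, v) \<in> parcs G \<longleftrightarrow> link n G 0 (int v - int u)"
proof -
  have "n > 0" using assms by simp
  then show ?thesis using link_diff[OF _ assms(1)] link_of_nat[OF assms(2,3)] by metis
qed

section \<open>Fixed points of permutations of prime power order\<close>

text \<open>Two periods \<open>p\<close> and \<open>a\<close> that are coprime force the period \<open>1\<close>.\<close>

lemma funpow_prime_period:
  assumes "prime p" "(f ^^ p) x = x" "(f ^^ a) x = x" "0 < a" "a < p"
  shows "f x = x"
proof -
  have "coprime a p" using assms by (metis coprime_commute nat_dvd_not_less prime_imp_coprime)
  then obtain b where b: "[a * b = 1] (mod p)" using cong_solve_coprime_nat by auto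
  have "1 < p" using assms(1) prime_gt_1_nat by blast
  then have "(f ^^ (a * b)) x = f x"
    using b funpow_mod_eq[OF assms(2), of "a * b"] by (simp add: cong_def)
  moreover have "(f ^^ (a * b)) x = x" using funpow_mod_eq[OF assms(3), of "a * b"] by simp
  ultimately show ?thesis by simp
qed

text \<open>The points that are not fixed fall into orbits of exactly \<open>p\<close> elements.\<close>

lemma card_fixpoints_prime:
  assumes p: "prime p" and fin: "finite X" and into: "\<And>x. x \<in> X \<Longrightarrow> f x \<in> X"
    and per: "\<And>x. x \<in> X \<Longrightarrow> (f ^^ p) x = x"
  shows "[card X = card {x \<in> X. f x = x}] (mod p)"
proof -
  define Y where "Y = X - {x \<in> X. f x = x}"
  define orb where "orb x = (\<lambda>i. (f ^^ i) x) ` {..<p}" for x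
  have p0: "0 < p" using p prime_gt_0_nat by blast
  have X: "(f ^^ i) x \<in> X" if "x \<in> X" for x i using that into by (induction i) auto
  have undo: "(f ^^ (p - i)) ((f ^^ i) x) = x" if "x \<in> X" "i < p" for x i
    using per[OF that(1)] that(2) by (metis add.commute comp_apply funpow_add le_add_diff_inverse less_imp_le)
  have Y: "(f ^^ i) x \<in> Y" if "x \<in> Y" "i < p" for x i
  proof (rule ccontr)
    assume "(f ^^ i) x \<notin> Y"
    then have fp: "f ((f ^^ i) x) = (f ^^ i) x" using that X by (auto simp: Y_def)
    have "(f ^^ j) ((f ^^ i) x) = (f ^^ i) x" for j
      by (induction j) (use fp in auto)
    then have "(f ^^ i) x = x" using undo[of x i] that by (auto simp: Y_def)
    then show False using fp that by (auto simp: Y_def)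
  qed
  have inj: "inj_on (\<lambda>i. (f ^^ i) x) {..<p}" if "x \<in> Y" for x
  proof (rule linorder_inj_onI)
    fix i j assume ij: "i < j" "i \<in> {..<p}" "j \<in> {..<p}"
    show "(f ^^ i) x \<noteq> (f ^^ j) x"
    proof
      assume eq: "(f ^^ i) x = (f ^^ j) x"
      have "(f ^^ (j - i)) x = (f ^^ (j - i)) ((f ^^ p) x)" using per that by (simp add: Y_def)
      also have "\<dots> = (f ^^ (p - i)) ((f ^^ j) x)"
        using ij by (simp flip: comp_apply[of "_ ^^ _"] funpow_add add: add.commute)
      also have "\<dots> = x" using eq undo[of x i] that ij by (auto simp: Y_def)
      finally have "(f ^^ (j - i)) x = x" .
      moreover have "0 < j - i" "j - i < p" "x \<in> X" using ij that by (auto simp: Y_def)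
      ultimately have "f x = x" using funpow_prime_period[OF p per] by blast
      then show False using that by (simp add: Y_def)
    qed
  qed auto
  have self: "x \<in> orb x" for x
    unfolding orb_def by (rule image_eqI[of _ _ 0]) (use p0 in auto)
  have sub: "orb y \<subseteq> orb x" if x: "x \<in> Y" and y: "y \<in> orb x" for x y
  proof
    fix z assume "z \<in> orb y"
    then obtain i j where "i < p" "j < p" "z = (f ^^ (j + i)) x"
      using y by (auto simp: orb_def funpow_add)
    then have "z = (f ^^ ((j + i) mod p)) x" using funpow_mod_eq[OF per, of x "j + i"] x by (simp add: Y_def)
    then show "z \<in> orb x" unfolding orb_def using p0 by auto
  qed
  have eq: "orb y = orb x" if x: "x \<in> Y" and y: "y \<in> orb x" for x y
  proof
    show "orb y \<subseteq> orb x" using sub that .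
    obtain i where i: "i < p" "y = (f ^^ i) x" using y by (auto simp: orb_def)
    have "y \<in> Y" using Y x i by simp
    moreover have "x = (f ^^ ((p - i) mod p)) y"
      using undo[of x i] i x \<open>y \<in> Y\<close> funpow_mod_eq[OF per, of y "p - i"] by (simp add: Y_def)
    then have "x \<in> orb y" unfolding orb_def using p0 by auto
    ultimately show "orb x \<subseteq> orb y" using sub by blast
  qed
  have U: "\<Union> (orb ` Y) = Y"
  proof
    show "\<Union> (orb ` Y) \<subseteq> Y" using Y unfolding orb_def by blast
    show "Y \<subseteq> \<Union> (orb ` Y)" using self by blast
  qed
  have "p dvd card (\<Union> (orb ` Y))"
  proof (rule dvd_partition)
    show "finite (\<Union> (orb ` Y))" using U fin by (simp add: Y_def)
    show "\<forall>c\<in>orb ` Y. p dvd card c" using inj by (auto simp: orb_def card_image)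
    show "\<forall>c1\<in>orb ` Y. \<forall>c2\<in>orb ` Y. c1 \<noteq> c2 \<longrightarrow> c1 \<inter> c2 = {}" using eq by blast
  qed
  then have "p dvd card Y" using U by simp
  moreover have "card X = card {x \<in> X. f x = x} + card Y"
    unfolding Y_def using fin card_Diff_subset[of "{x \<in> X. f x = x}" X] card_mono[OF fin, of "{x \<in> X. f x = x}"]
    by auto
  ultimately show ?thesis by (auto simp: cong_def elim: dvdE)
qed

text \<open>Induction on \<open>k\<close>: the power \<open>f ^^ p\<close> has a smaller period, and on its fixed points
  \<open>f\<close> itself has period \<open>p\<close>.\<close>

lemma card_fixpoints_prime_power:
  assumes p: "prime p" and fin: "finite X" and into: "\<And>x. x \<in> X \<Longrightarrow> f x \<in> X"
    and per: "\<And>x. x \<in> X \<Longrightarrow> (f ^^ (p ^ k)) x = x"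
  shows "[card X = card {x \<in> X. f x = x}] (mod p)"
  using into per
proof (induction k arbitrary: f)
  case 0
  then have "{x \<in> X. f x = x} = X" by auto
  then show ?case by simp
next
  case (Suc k)
  define Y where "Y = {x \<in> X. (f ^^ p) x = x}"
  have iter: "(f ^^ i) x \<in> X" if "x \<in> X" for x i using that Suc.prems(1) by (induction i) auto
  have "[card X = card Y] (mod p)"
    unfolding Y_def by (rule Suc.IH) (use Suc.prems(2) iter in \<open>auto simp: funpow_mult mult.commute\<close>)
  moreover have "[card Y = card {x \<in> Y. f x = x}] (mod p)"
    by (rule card_fixpoints_prime[OF p]) (use fin Suc.prems(1) in \<open>auto simp: Y_def funpow_swap1[symmetric]\<close>)
  moreover have "{x \<in> Y. f x = x} = {x \<in> X. f x = x}"
  proof -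
    have "(f ^^ p) x = x" if "f x = x" for x using that by (induction p) auto
    then show ?thesis by (auto simp: Y_def)
  qed
  ultimately show ?case using cong_trans by metis
qed

lemma conjugate_funpow:
  fixes g t h :: "'a \<Rightarrow> 'a"
  shows "((\<lambda>t. g \<circ> t \<circ> h) ^^ i) t = (g ^^ i) \<circ> t \<circ> (h ^^ i)"
proof (induction i)
  case (Suc i)
  have "g \<circ> (g ^^ i \<circ> t \<circ> h ^^ i) \<circ> h = (g \<circ> g ^^ i) \<circ> t \<circ> (h ^^ i \<circ> h)"
    by (simp add: comp_assoc)
  also have "h ^^ i \<circ> h = h \<circ> h ^^ i" by (rule ext) (simp add: funpow_swap1)
  finally show ?case using Suc by simp
qed simp

text \<open>The part of Sylow's conjugacy theorem needed here.  The set \<open>X\<close> of conjugates of \<open>r\<close> is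
  permuted by conjugation with \<open>r\<close> and with \<open>d\<close>.  The fixed points of the first action form \<open>F\<close>,
  so \<open>card X\<close> is not divisible by \<open>p\<close>; hence the second action has a fixed point too.\<close>

lemma exists_commuting_conjugate:
  assumes p: "prime p" and fin: "finite A" and bij: "\<And>f. f \<in> A \<Longrightarrow> bij f"
    and comp: "\<And>f g. f \<in> A \<Longrightarrow> g \<in> A \<Longrightarrow> f \<circ> g \<in> A"
    and r: "r \<in> A" "r ^^ (p ^ k) = id" and d: "d \<in> A" "d ^^ (p ^ k) = id"
    and F: "F = {t \<in> (\<lambda>f. f \<circ> r \<circ> inv f) ` A. t \<circ> r = r \<circ> t}" "0 < card F" "card F < p"
  shows "\<exists>f\<in>A. (f \<circ> r \<circ> inv f) \<circ> d = d \<circ> (f \<circ> r \<circ> inv f)"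
proof -
  define X where "X = (\<lambda>f. f \<circ> r \<circ> inv f) ` A"
  have count: "[card X = card {t \<in> X. t \<circ> e = e \<circ> t}] (mod p)"
    if e: "e \<in> A" "e ^^ (p ^ k) = id" for e
  proof -
    let ?c = "\<lambda>t. e \<circ> t \<circ> inv e"
    have be: "bij e" using bij e by blast
    have "[card X = card {t \<in> X. ?c t = t}] (mod p)"
    proof (rule card_fixpoints_prime_power[OF p])
      show "finite X" unfolding X_def using fin by simp
      show "?c t \<in> X" if "t \<in> X" for t
      proof -
        obtain f where f: "f \<in> A" "t = f \<circ> r \<circ> inv f" using \<open>t \<in> X\<close> by (auto simp: X_def)
        have "?c t = (e \<circ> f) \<circ> r \<circ> inv (e \<circ> f)"
          using o_inv_distrib[OF be bij[OF f(1)]] f(2) by (simp add: comp_assoc)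
        then show ?thesis using comp[OF e(1) f(1)] unfolding X_def by blast
      qed
      show "(?c ^^ (p ^ k)) t = t" for t
        unfolding conjugate_funpow using e(2) inv_fn[OF be, of "p ^ k"] by simp
    qed
    moreover have "?c t = t \<longleftrightarrow> t \<circ> e = e \<circ> t" for t
    proof
      assume "?c t = t"
      then have "t \<circ> e = e \<circ> t \<circ> (inv e \<circ> e)" by (metis comp_assoc)
      then show "t \<circ> e = e \<circ> t" using be by (simp add: bij_is_inj)
    next
      assume "t \<circ> e = e \<circ> t"
      then have "?c t = t \<circ> (e \<circ> inv e)" by (metis comp_assoc)
      then show "?c t = t" using be surj_iff[of e] by (simp add: bij_is_surj)
    qed
    ultimately show ?thesis by simp
  qed
  have "[card X = card F] (mod p)" using count[OF r] unfolding F(1) X_def .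
  then have "card X mod p \<noteq> 0" using F(2,3) by (simp add: cong_def)
  then have "card {t \<in> X. t \<circ> d = d \<circ> t} mod p \<noteq> 0" using count[OF d] by (simp add: cong_def)
  then have "{t \<in> X. t \<circ> d = d \<circ> t} \<noteq> {}" by (metis card.empty mod_0)
  then show ?thesis unfolding X_def by blast
qed

section \<open>Rotations and multipliers\<close>

definition rot :: "nat \<Rightarrow> nat \<Rightarrow> nat" where
  "rot n x = (if x < n then (x + 1) mod n else x)"

lemma rot_funpow: "(rot n ^^ k) x = (if x < n then (x + k) mod n else x)"
  by (induction k) (auto simp: rot_def mod_Suc_eq)

lemma rot_funpow_self: "rot n ^^ n = id"
  by (rule ext) (simp add: rot_funpow)

lemma rot_permutes: "rot n permutes {..<n}"
proof (rule bij_imp_permutes)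
  have "inj_on (rot n) {..<n}"
  proof (rule inj_onI)
    fix x y assume xy: "x \<in> {..<n}" "y \<in> {..<n}" "rot n x = rot n y"
    then have "(x + 1) mod n = (y + 1) mod n" by (simp add: rot_def)
    then have "x mod n = y mod n" using cong_add_rcancel_nat[of x 1 y n] unfolding cong_def by blast
    then show "x = y" using xy by simp
  qed
  moreover have "rot n ` {..<n} \<subseteq> {..<n}" by (auto simp: rot_def)
  ultimately show "bij_betw (rot n) {..<n} {..<n}"
    by (simp add: bij_betw_def endo_inj_surj)
qed (simp add: rot_def)

text \<open>A map that conjugates the rotation into one of its powers is affine.\<close>

lemma rot_intertwine:
  assumes "f \<circ> rot n = (rot n ^^ m) \<circ> f" "f permutes {..<n}" "x < n"
  shows "f x = (f 0 + m * x) mod n"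
  using assms(3)
proof (induction x)
  case 0
  then show ?case using permutes_in_image[OF assms(2), of 0] by simp
next
  case (Suc x)
  have "f (rot n x) = (rot n ^^ m) (f x)" using fun_cong[OF assms(1), of x] by simp
  moreover have "rot n x = Suc x" "f x < n"
    using Suc.prems permutes_in_image[OF assms(2), of x] by (simp_all add: rot_def)
  ultimately have "f (Suc x) = (f x + m) mod n" by (simp add: rot_funpow)
  then show ?case using Suc by (simp add: mod_simps algebra_simps)
qed

text \<open>The centraliser of a full cycle consists of its powers.\<close>

lemma rot_commute:
  assumes "t \<circ> rot n = rot n \<circ> t" "t permutes {..<n}"
  shows "t = rot n ^^ t 0"
proof (cases "n = 0")
  case True
  then show ?thesis using assms(2) by (auto simp: rot_def fun_eq_iff rot_funpow)
next
  case False
  show ?thesis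
  proof
    fix x show "t x = (rot n ^^ t 0) x"
      using rot_intertwine[of t n 1 x] assms permutes_not_in[OF assms(2), of x]
      by (simp add: rot_funpow add.commute)
  qed
qed

lemma rot_isom:
  assumes "n > 0" "G \<in> circulants n" shows "isom (rot n) G G"
  unfolding isom_def circulant_pverts[OF assms(2)]
proof (intro conjI ballI)
  show "bij_betw (rot n) {..<n} {..<n}" by (rule permutes_imp_bij[OF rot_permutes])
  show "(u, v) \<in> parcs G \<longleftrightarrow> (rot n u, rot n v) \<in> parcs G" if "u \<in> {..<n}" "v \<in> {..<n}" for u v
    using circulant_step[OF assms(2), of u v] that by (simp add: rot_def)
qed

text \<open>An affine isomorphism may be replaced by its linear part, as the translations are
  automorphisms of a circulant.\<close>

lemma multiplier_isom:
  assumes "n > 0" and G: "G \<in> circulants n" and H: "H \<in> circulants n"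
    and f: "f permutes {..<n}" "isom f G H" and comm: "f \<circ> rot n = (rot n ^^ m) \<circ> f"
  shows "link n G 0 d \<longleftrightarrow> link n H 0 (int m * d)" and "\<exists>m'. [int m * m' = 1] (mod int n)"
proof -
  note fx = rot_intertwine[OF comm f(1)]
  have im: "f x < n" if "x < n" for x using that permutes_in_image[OF f(1), of x] by simp
  define x where "x = nat (d mod int n)"
  have x: "x < n" "[int x = d] (mod int n)" using assms(1) by (simp_all add: x_def nat_less_iff cong_def)
  have "link n G 0 d \<longleftrightarrow> (0, x) \<in> parcs G" by (simp add: link_def x_def)
  also have "\<dots> \<longleftrightarrow> (f 0, f x) \<in> parcs H"
    using f(2)[unfolded isom_def circulant_pverts[OF G], THEN conjunct2, rule_format, of 0 x]
      x(1) assms(1) by simp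
  also have "\<dots> \<longleftrightarrow> link n H 0 (int (f x) - int (f 0))"
    using circulant_arc_iff[OF H] im x(1) assms(1) by blast
  also have "\<dots> \<longleftrightarrow> link n H 0 (int m * d)"
  proof (rule link_cong)
    have "[int (f x) = int (f 0) + int m * int x] (mod int n)"
      by (subst fx[OF x(1)]) (simp add: cong_def zmod_int)
    also have "[int (f 0) + int m * int x = int (f 0) + int m * d] (mod int n)"
      using x(2) by (intro cong_add cong_mult) auto
    finally have "[int (f x) - int (f 0) = int (f 0) + int m * d - int (f 0)] (mod int n)"
      by (intro cong_diff) auto
    then show "[int (f x) - int (f 0) = int m * d] (mod int n)" by simp
  qed simp
  finally show "link n G 0 d \<longleftrightarrow> link n H 0 (int m * d)" .
next
  have "(f 0 + 1) mod n \<in> f ` {..<n}" using permutes_image[OF f(1)] assms(1) by simp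
  then obtain y where y: "y < n" "f y = (f 0 + 1) mod n" by auto
  then have "[f 0 + m * y = f 0 + 1] (mod n)" using rot_intertwine[OF comm f(1) y(1)] by (simp add: cong_def)
  then have "[m * y = 1] (mod n)" using cong_add_lcancel_nat by blast
  then have "[int m * int y = 1] (mod int n)" by (metis cong_int_iff of_nat_1 of_nat_mult)
  then show "\<exists>m'. [int m * m' = 1] (mod int n)" by blast
qed

section \<open>Self-complementary circulants that are not wreath products\<close>

text \<open>In terms of the connection set: its elements prime to \<open>p\<close> form a union of cosets
  of \<open>p\<int>\<close>.\<close>

definition uniform :: "nat \<Rightarrow> nat pair_pre_digraph \<Rightarrow> bool" where
  "uniform p G \<longleftrightarrow> (\<forall>d e. \<not> int p dvd d \<longrightarrow> link (p * p) G 0 (d + int p * e) = link (p * p) G 0 d)"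

lemma link_compl:
  assumes "n > 0"
  shows "link n (compl_digraph G) x y \<longleftrightarrow> pverts G \<supseteq> {nat (x mod int n), nat (y mod int n)} \<and>
    \<not> [x = y] (mod int n) \<and> \<not> link n G x y"
  using assms by (auto simp: link_def compl_digraph_def cong_def nat_eq_iff)

lemma link_compl_circulant:
  assumes "n > 0" "G \<in> circulants n"
  shows "link n (compl_digraph G) 0 d \<longleftrightarrow> \<not> int n dvd d \<and> \<not> link n G 0 d"
  using assms by (subst link_compl)
    (auto simp: circulant_pverts[OF assms(2)] nat_less_iff cong_0_iff cong_sym_eq[of 0])

lemma not_dvd_of_inverse:
  assumes "prime p" "[m * w = 1] (mod int p * int p)"
  shows "\<not> int p dvd m" "\<not> int p dvd w"
proof -
  have "[m * w = 1] (mod int p)" using assms(2) by (rule cong_dvd_modulus) simp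
  moreover have "\<not> int p dvd 1" using assms(1) prime_gt_1_nat by fastforce
  ultimately have "\<not> int p dvd m * w" by (simp add: cong_dvd_iff)
  then show "\<not> int p dvd m" "\<not> int p dvd w" by auto
qed

text \<open>The quotient of the two multipliers is \<open>1 + p c\<close> with \<open>c\<close> prime to \<open>p\<close>.  Its powers are
  \<open>1 + j p c\<close> modulo \<open>p\<^sup>2\<close>, and they move a unit \<open>y\<close> through the whole coset \<open>y + p\<int>\<close>.\<close>

lemma congruent_multipliers_imp_uniform:
  assumes p: "prime p" and m: "m < p * p" "m' < p * p" "m \<noteq> m'" "[m = m'] (mod p)"
    and L: "\<And>d. link (p * p) G 0 d \<longleftrightarrow> link (p * p) G 0 (int m * d)"
    and L': "\<And>d. link (p * p) G 0 d \<longleftrightarrow> link (p * p) G 0 (int m' * d)"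
    and w: "[int m' * w = 1] (mod int (p * p))"
  shows "uniform p G"
proof -
  let ?L = "link (p * p) G 0" and ?p = "int p"
  have pp: "prime ?p" using p by simp
  have "[int m' = int m] (mod ?p)" using m(4) by (simp add: cong_int_iff cong_sym_eq)
  then obtain k where k: "int m = int m' + ?p * k" by (auto simp: cong_iff_lin)
  have k0: "\<not> ?p dvd k"
  proof
    assume "?p dvd k"
    then have "int (p * p) dvd int m - int m'" using k by simp
    then have "[int m = int m'] (mod int (p * p))" by (simp add: cong_iff_dvd_diff)
    then have "[m = m'] (mod (p * p))" by (simp only: cong_int_iff)
    then show False using m by (simp add: cong_def)
  qed
  define c where "c = k * w"
  have c0: "\<not> ?p dvd c"
    using k0 not_dvd_of_inverse[OF p, of "int m'" w] w pp by (simp add: c_def prime_dvd_mult_iff)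
  have step: "?L (y + ?p * c * y) = ?L y" for y
  proof -
    have 1: "[int m' * (w * y) = y] (mod int (p * p))"
      using cong_scalar_right[OF w, of y] by (simp add: mult.assoc)
    have "int m * (w * y) = int m' * (w * y) + ?p * c * y"
      by (simp add: k c_def algebra_simps)
    then have "?L (w * y) = ?L (int m' * (w * y) + ?p * c * y)"
      using L[of "w * y"] by simp
    also have "\<dots> = ?L (y + ?p * c * y)"
      using 1 by (intro link_cong cong_add) auto
    finally have "?L (y + ?p * c * y) = ?L (w * y)" by simp
    also have "\<dots> = ?L (int m' * (w * y))" by (rule L')
    also have "\<dots> = ?L y" using 1 by (intro link_cong) auto
    finally show ?thesis .
  qed
  have iter: "?L (y + int j * (?p * c * y)) = ?L y" for y j
  proof (induction j)
    case (Suc j)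
    let ?z = "y + int j * (?p * c * y)"
    have "[y + int (Suc j) * (?p * c * y) = ?z + ?p * c * ?z] (mod int (p * p))"
      unfolding cong_iff_dvd_diff by (rule dvdI[of _ _ "- int j * c * c * y"]) (simp add: algebra_simps)
    then have "?L (y + int (Suc j) * (?p * c * y)) = ?L (?z + ?p * c * ?z)"
      by (intro link_cong) auto
    then show ?case using step[of ?z] Suc by simp
  qed simp
  show ?thesis
    unfolding uniform_def
  proof (intro allI impI)
    fix d e assume d: "\<not> ?p dvd d"
    have "coprime ?p (c * d)" using d c0 pp by (simp add: prime_imp_coprime prime_dvd_mult_iff)
    then have "coprime (c * d) ?p" by (simp add: coprime_commute)
    then obtain x where x: "[c * d * x = 1] (mod ?p)" using cong_solve_coprime_int by blast
    define j where "j = nat ((x * e) mod ?p)"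
    have j: "[int j = x * e] (mod ?p)" using p prime_gt_0_nat[of p] by (simp add: j_def cong_def)
    have "[c * d * int j = c * d * (x * e)] (mod ?p)" using j by (rule cong_scalar_left)
    also have "c * d * (x * e) = c * d * x * e" by simp
    also have "[\<dots> = 1 * e] (mod ?p)" using x by (rule cong_scalar_right)
    finally have "?p dvd c * d * int j - e" by (simp add: cong_iff_dvd_diff)
    then have "?p * ?p dvd ?p * (c * d * int j - e)" by simp
    then have "[d + int j * (?p * c * d) = d + ?p * e] (mod int (p * p))"
      unfolding cong_iff_dvd_diff by (simp add: algebra_simps)
    then have "?L (d + int j * (?p * c * d)) = ?L (d + ?p * e)" by (intro link_cong) auto
    then show "?L (d + ?p * e) = ?L d" using iter by simp
  qed
qed

lemma isom_inv:
  assumes "isom f G H" "f permutes pverts G" "pverts H = pverts G"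
  shows "isom (inv f) H G"
  unfolding isom_def
proof (intro conjI ballI)
  show "bij_betw (inv f) (pverts H) (pverts G)"
    using permutes_imp_bij[OF permutes_inv[OF assms(2)]] assms(3) by simp
  fix u v assume "u \<in> pverts H" "v \<in> pverts H"
  then have "inv f u \<in> pverts G" "inv f v \<in> pverts G"
    using permutes_in_image[OF permutes_inv[OF assms(2)]] assms(3) by simp_all
  then show "(u, v) \<in> parcs H \<longleftrightarrow> (inv f u, inv f v) \<in> parcs G"
    using assms(1) permutes_inverses(1)[OF assms(2)] unfolding isom_def by metis
qed

text \<open>Let \<open>s\<close> be an isomorphism onto the complement.  Both the rotation and its conjugate
  \<open>d = s\<^sup>-\<^sup>1 \<circ> rot \<circ> s\<close> are automorphisms of \<open>G\<close>.  A conjugate of the rotation by an automorphism \<open>f\<close>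
  commutes with \<open>d\<close>; then \<open>h = f\<^sup>-\<^sup>1 \<circ> s\<^sup>-\<^sup>1\<close> conjugates the rotation into one of its powers.\<close>

lemma complementing_multiplier:
  assumes p: "prime p" and G: "G \<in> circulants (p * p)"
    and sc: "isomorphic G (compl_digraph G)" and nu: "\<not> uniform p G"
  shows "\<exists>m w. (\<forall>d. link (p * p) (compl_digraph G) 0 d \<longleftrightarrow> link (p * p) G 0 (int m * d)) \<and>
    [int m * w = 1] (mod int (p * p))"
proof -
  define n where "n = p * p"
  have n0: "n > 0" unfolding n_def using p prime_gt_0_nat by auto
  note G = G[folded n_def]
  let ?H = "compl_digraph G" and ?U = "{..<n}"
  have H: "?H \<in> circulants n" using compl_circulant[OF n0 G] .
  have VG: "pverts G = ?U" and VH: "pverts ?H = ?U" using circulant_pverts G H by auto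
  define A where "A = {f. f permutes ?U \<and> isom f G G}"
  obtain s0 where s0: "isom s0 G ?H" using sc by (auto simp: isomorphic_def)
  define s where "s x = (if x < n then s0 x else x)" for x
  have s: "s permutes ?U" "isom s G ?H"
  proof -
    have b: "bij_betw s0 ?U ?U" using s0 VG VH by (simp add: isom_def)
    have b': "bij_betw s ?U ?U"
      using b by (rule iffD1[OF bij_betw_cong, rotated]) (simp add: s_def)
    then show "s permutes ?U" by (rule bij_imp_permutes) (simp add: s_def)
    show "isom s G ?H"
      using s0 b' unfolding isom_def VG VH by (simp add: s_def)
  qed
  have si: "inv s permutes ?U" "isom (inv s) ?H G"
    using permutes_inv[OF s(1)] isom_inv[OF s(2)] s(1) VG VH by auto
  have bijA: "bij f" if "f \<in> A" for f using that permutes_bij by (auto simp: A_def)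
  define d where "d = inv s \<circ> rot n \<circ> s"
  have dA: "d \<in> A"
    unfolding A_def d_def
    using permutes_compose[OF permutes_compose[OF s(1) rot_permutes] si(1)]
      isom_comp[OF isom_comp[OF s(2) rot_isom[OF n0 H]] si(2)] by (simp add: comp_assoc)
  have npk: "p ^ 2 = n" by (simp add: n_def power2_eq_square)
  have dn: "d ^^ (p ^ 2) = id"
    unfolding npk d_def
  proof -
    have "(inv s \<circ> rot n \<circ> s) ^^ k = inv s \<circ> (rot n ^^ k) \<circ> s" for k
    proof (induction k)
      case 0 show ?case using permutes_inv_o(2)[OF s(1)] by simp
    next
      case (Suc k)
      have "s (inv s x) = x" for x using permutes_inverses(1)[OF s(1)] .
      then show ?case unfolding funpow.simps Suc by (simp add: fun_eq_iff)
    qed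
    then show "(inv s \<circ> rot n \<circ> s) ^^ n = id"
      using permutes_inv_o(2)[OF s(1)] by (simp add: rot_funpow_self)
  qed
  have rA: "rot n \<in> A" using rot_permutes rot_isom[OF n0 G] by (simp add: A_def)
  have idA: "id \<in> A" using isom_id permutes_id by (auto simp: A_def)
  have finA: "finite A"
    using finite_permutations[of ?U] by (rule rev_finite_subset) (auto simp: A_def)
  define F where "F = {t \<in> (\<lambda>f. f \<circ> rot n \<circ> inv f) ` A. t \<circ> rot n = rot n \<circ> t}"
  have finF: "finite F" using finA by (simp add: F_def)
  have "rot n \<in> F" unfolding F_def using idA by force
  then have F0: "0 < card F" using finF card_gt_0_iff by blast
  have Fm: "t 0 < n \<and> t = rot n ^^ t 0 \<and> (\<forall>d. link n G 0 d \<longleftrightarrow> link n G 0 (int (t 0) * d))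
      \<and> (\<exists>w. [int (t 0) * w = 1] (mod int n))" if "t \<in> F" for t
  proof -
    obtain f where f: "f permutes ?U" "isom f G G" "t = f \<circ> rot n \<circ> inv f"
      using \<open>t \<in> F\<close> by (auto simp: F_def A_def)
    have tp: "t permutes ?U"
      unfolding f(3) by (intro permutes_compose permutes_inv f(1) rot_permutes)
    have tr: "t = rot n ^^ t 0" using that tp by (intro rot_commute) (simp_all add: F_def)
    have "f \<circ> rot n = t \<circ> f" unfolding f(3) using permutes_inv_o(2)[OF f(1)] by (simp add: comp_assoc)
    then have c: "f \<circ> rot n = (rot n ^^ t 0) \<circ> f" using tr by simp
    have "t 0 < n" using permutes_in_image[OF tp, of 0] n0 by simp
    then show ?thesis using tr multiplier_isom[OF n0 G G f(1,2) c] by blast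
  qed
  \<comment> \<open>The multipliers \<open>t 0\<close> for \<open>t \<in> F\<close> are units, and pairwise incongruent mod \<open>p\<close> by non-uniformity.\<close>
  have "card F \<le> card {1..<p}"
  proof (rule card_inj_on_le)
    show "inj_on (\<lambda>t. t 0 mod p) F"
    proof (rule inj_onI, rule ccontr)
      fix t t' assume t: "t \<in> F" "t' \<in> F" "t 0 mod p = t' 0 mod p" "t \<noteq> t'"
      then have "t 0 \<noteq> t' 0" using Fm by metis
      obtain w where "[int (t' 0) * w = 1] (mod int n)" using Fm[OF t(2)] by blast
      note w = this[unfolded n_def]
      note m = Fm[OF t(1), unfolded n_def] and m' = Fm[OF t(2), unfolded n_def]
      have "uniform p G"
      proof (rule congruent_multipliers_imp_uniform[OF p _ _ \<open>t 0 \<noteq> t' 0\<close> _ _ _ w])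
        show "[t 0 = t' 0] (mod p)" using t(3) by (simp add: cong_def)
      qed (rule m[THEN conjunct1] m'[THEN conjunct1]
          m[THEN conjunct2, THEN conjunct2, THEN conjunct1, rule_format]
          m'[THEN conjunct2, THEN conjunct2, THEN conjunct1, rule_format])+
      then show False using nu by contradiction
    qed
    show "(\<lambda>t. t 0 mod p) ` F \<subseteq> {1..<p}"
    proof
      fix a assume "a \<in> (\<lambda>t. t 0 mod p) ` F"
      then obtain t where t: "t \<in> F" "a = t 0 mod p" by blast
      obtain w where "[int (t 0) * w = 1] (mod int n)" using Fm[OF t(1)] by blast
      then have "\<not> p dvd t 0" using not_dvd_of_inverse(1)[OF p, of "int (t 0)" w] by (simp add: n_def)
      then show "a \<in> {1..<p}" using t(2) p prime_gt_0_nat[of p] by (auto simp: dvd_eq_mod_eq_0)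
    qed
  qed simp
  then have F1: "card F < p" using p prime_gt_0_nat[of p] by simp
  obtain f where f: "f \<in> A" "(f \<circ> rot n \<circ> inv f) \<circ> d = d \<circ> (f \<circ> rot n \<circ> inv f)"
  proof -
    have "\<exists>f\<in>A. (f \<circ> rot n \<circ> inv f) \<circ> d = d \<circ> (f \<circ> rot n \<circ> inv f)"
    proof (rule exists_commuting_conjugate[OF p finA bijA])
      show "f \<circ> g \<in> A" if "f \<in> A" "g \<in> A" for f g
        using that permutes_compose isom_comp unfolding A_def by blast
      show "rot n ^^ (p ^ 2) = id" unfolding npk by (rule rot_funpow_self)
    qed (use rA dA dn F_def F0 F1 in auto)
    then show ?thesis using that by blast
  qed
  have fp: "f permutes ?U" and fi: "isom f G G" using f(1) by (auto simp: A_def)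
  define h where "h = inv f \<circ> inv s"
  have hp: "h permutes ?U" unfolding h_def by (intro permutes_compose permutes_inv fp s(1))
  have hi: "isom h ?H G"
    unfolding h_def using isom_comp[OF si(2) isom_inv[OF fi]] fp VG by simp
  define t where "t = inv f \<circ> d \<circ> f"
  have tp: "t permutes ?U"
    unfolding t_def using dA by (intro permutes_compose permutes_inv fp) (auto simp: A_def)
  have ff: "inv f (f x) = x" "f (inv f x) = x" for x using permutes_inverses[OF fp] by auto
  have ss: "inv s (s x) = x" "s (inv s x) = x" for x using permutes_inverses[OF s(1)] by auto
  have "t (rot n x) = rot n (t x)" for x
    using fun_cong[OF f(2), of "f x"] by (simp add: t_def ff) (metis ff)
  then have "t \<circ> rot n = rot n \<circ> t" by (simp add: fun_eq_iff)
  then have tr: "t = rot n ^^ t 0" using tp by (rule rot_commute)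
  have "h \<circ> rot n = t \<circ> h" by (simp add: fun_eq_iff h_def t_def d_def ff ss)
  then have "h \<circ> rot n = (rot n ^^ t 0) \<circ> h" using tr by simp
  from multiplier_isom[OF n0 H G hp hi this] show ?thesis unfolding n_def by blast
qed

lemma power_cong_1_int:
  fixes m w :: int
  assumes "n > 0" "[m * w = 1] (mod int n)"
  shows "\<exists>N>0. [m ^ N = 1] (mod int n)"
proof -
  let ?f = "\<lambda>i. m ^ i mod int n"
  have "\<not> inj_on ?f {..n}"
  proof
    assume i: "inj_on ?f {..n}"
    have sub: "?f ` {..n} \<subseteq> {0..<int n}" using assms(1) by auto
    have "card {..n} \<le> card {0..<int n}" using card_inj_on_le[OF i sub] by simp
    then show False by simp
  qed
  then obtain i j where "i < j" "m ^ i mod int n = m ^ j mod int n"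
    unfolding inj_on_def by (metis linorder_neqE_nat)
  then have ij: "[m ^ (i + (j - i)) = m ^ i] (mod int n)" "0 < j - i" by (auto simp: cong_def)
  have wi: "[w ^ i * m ^ i = 1] (mod int n)"
    using cong_pow[OF assms(2), of i] by (simp add: power_mult_distrib mult.commute)
  have "[m ^ (j - i) * 1 = m ^ (j - i) * (w ^ i * m ^ i)] (mod int n)"
    using wi by (intro cong_mult cong_refl) (rule cong_sym)
  also have "m ^ (j - i) * (w ^ i * m ^ i) = w ^ i * m ^ (i + (j - i))" by (simp add: power_add)
  also have "[\<dots> = w ^ i * m ^ i] (mod int n)" using ij(1) by (rule cong_scalar_left)
  also note wi
  finally have "[m ^ (j - i) = 1] (mod int n)" by simp
  then show ?thesis using ij(2) by blast
qed

text \<open>As \<open>p\<close> is odd, it cannot divide both \<open>z - 1\<close> and \<open>z + 1\<close>.\<close>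

lemma square_root_of_1:
  assumes p: "prime p" "odd p" and z: "[z * z = 1] (mod int p * int p)" "\<not> [z = 1] (mod int p * int p)"
  shows "[z = - 1] (mod int p * int p)"
proof -
  let ?p = "int p"
  have pp: "prime ?p" using p by simp
  have dvd: "?p * ?p dvd (z - 1) * (z + 1)" using z(1) by (simp add: cong_iff_dvd_diff algebra_simps)
  have "\<not> (?p dvd z - 1 \<and> ?p dvd z + 1)"
  proof
    assume "?p dvd z - 1 \<and> ?p dvd z + 1"
    then have "?p dvd (z + 1) - (z - 1)" using dvd_diff by blast
    then have "?p dvd 2" by simp
    then have "p dvd 2" by (metis int_dvd_int_iff of_nat_numeral)
    then have "p = 1 \<or> p = 2" by (metis prime_nat_iff two_is_prime_nat)
    then show False using p by auto
  qed
  moreover have "?p * ?p dvd z + 1" if "\<not> ?p dvd z - 1"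
  proof -
    have "coprime (?p * ?p) (z - 1)" using that pp by (simp add: prime_imp_coprime)
    then show ?thesis using dvd coprime_dvd_mult_right_iff by blast
  qed
  moreover have "?p * ?p dvd z - 1" if "\<not> ?p dvd z + 1"
  proof -
    have "coprime (?p * ?p) (z + 1)" using that pp by (simp add: prime_imp_coprime)
    then show ?thesis using dvd coprime_dvd_mult_left_iff by blast
  qed
  ultimately show ?thesis using z(2) by (auto simp: cong_iff_dvd_diff)
qed

lemma symmetricI_link:
  assumes "G \<in> circulants n" "\<And>d. link n G 0 d \<Longrightarrow> link n G 0 (- d)"
  shows "symmetric (with_proj G)"
proof -
  have "(v, u) \<in> parcs G" if "(u, v) \<in> parcs G" for u v
    using that circulant_arcD(1,2)[OF assms(1) that] assms(2)[of "int v - int u"]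
    by (simp add: circulant_arc_iff[OF assms(1)])
  then show ?thesis by (simp add: symmetric_def sym_def)
qed

lemma tournamentI_link:
  assumes "G \<in> circulants n" "\<And>d. \<not> int n dvd d \<Longrightarrow> link n G 0 (- d) \<longleftrightarrow> \<not> link n G 0 d"
  shows "tournament G"
  unfolding tournament_def circulant_pverts[OF assms(1)]
proof (intro conjI ballI impI circulant_digraph[OF assms(1)])
  fix u v assume uv: "u \<in> {..<n}" "v \<in> {..<n}" "u \<noteq> v"
  have "\<not> int n dvd int v - int u"
  proof
    assume "int n dvd int v - int u"
    then have "[int v = int u] (mod int n)" by (simp add: cong_iff_dvd_diff)
    then have "[v = u] (mod n)" by (simp only: cong_int_iff)
    then show False using uv by (simp add: cong_def)
  qed
  then show "((u, v) \<in> parcs G) \<noteq> ((v, u) \<in> parcs G)"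
    using uv assms(2)[of "int v - int u"] by (simp add: circulant_arc_iff[OF assms(1)])
qed

text \<open>Odd powers of a complementing multiplier complement and even powers fix, so its order is even
  and half of that order yields a nontrivial square root of \<open>1\<close>, which is \<open>-1\<close>.\<close>

lemma symmetric_or_tournament:
  assumes p: "prime p" "odd p" and G: "G \<in> circulants (p * p)"
    and sc: "isomorphic G (compl_digraph G)" and nu: "\<not> uniform p G"
  shows "symmetric (with_proj G) \<or> tournament G"
proof -
  define n where "n = p * p"
  note G = G[folded n_def]
  have n1: "n > 1" unfolding n_def using prime_gt_1_nat[OF p(1)] by (metis less_1_mult)
  let ?L = "link n G 0"
  from complementing_multiplier[OF p(1) G[unfolded n_def] sc nu, folded n_def]
  obtain m w where mL: "\<forall>d. link n (compl_digraph G) 0 d \<longleftrightarrow> ?L (int m * d)"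
    and mw: "[int m * w = 1] (mod int n)"
    by (elim exE conjE)
  have dv: "int n dvd int m * d \<longleftrightarrow> int n dvd d" for d
  proof -
    have "coprime (int m) (int n)" using mw by (auto simp: coprime_iff_invertible_int)
    then show ?thesis by (simp add: coprime_commute coprime_dvd_mult_right_iff)
  qed
  have step: "?L (int m * d) \<longleftrightarrow> \<not> ?L d" if "\<not> int n dvd d" for d
    using mL[rule_format, of d] link_compl_circulant[OF _ G, of d] n1 that by auto
  have pow: "\<not> int n dvd int m ^ i * d \<and> (?L (int m ^ i * d) \<longleftrightarrow> (even i \<longleftrightarrow> ?L d))"
    if "\<not> int n dvd d" for d i
  proof (induction i)
    case (Suc i)
    then show ?case using dv step[of "int m ^ i * d"] by (auto simp: mult.assoc)
  qed (use that in simp)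
  define N where "N = (LEAST N. N > 0 \<and> [int m ^ N = 1] (mod int n))"
  have N: "N > 0 \<and> [int m ^ N = 1] (mod int n)"
    unfolding N_def by (rule LeastI_ex, rule power_cong_1_int[OF _ mw]) (use n1 in simp)
  have least: "\<not> [int m ^ i = 1] (mod int n)" if "0 < i" "i < N" for i
    using not_less_Least[of i "\<lambda>N. N > 0 \<and> [int m ^ N = 1] (mod int n)"] that unfolding N_def by blast
  have "even N"
  proof -
    have "?L (int m ^ N * 1) = ?L 1" using N by (intro link_cong) auto
    then show ?thesis using pow[of 1 N] n1 by auto
  qed
  then obtain M where "N = 2 * M" by (rule evenE)
  then have M: "N = M + M" by simp
  define z where "z = int m ^ M"
  have "[z * z = 1] (mod int n)" using N by (simp add: z_def M power_add)
  moreover have "\<not> [z = 1] (mod int n)" unfolding z_def using N M by (intro least) auto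
  ultimately have z: "[z = - 1] (mod int n)" using square_root_of_1[OF p, of z] by (simp add: n_def)
  have neg: "?L (- d) \<longleftrightarrow> (even M \<longleftrightarrow> ?L d)" if "\<not> int n dvd d" for d
  proof -
    have "?L (- d) = ?L (z * d)"
      using cong_sym[OF cong_scalar_right[OF z, of d]] by (intro link_cong) simp_all
    then show ?thesis using pow[OF that, of M] by (simp add: z_def)
  qed
  show ?thesis
  proof (cases "even M")
    case True
    have "?L (- d)" if "?L d" for d
    proof -
      have "\<not> [0 = d] (mod int n)" using link_irrefl[OF G, of 0 d] that by blast
      then have "\<not> int n dvd d" by (metis cong_0_iff cong_sym)
      then show ?thesis using neg True that by simp
    qed
    then show ?thesis using symmetricI_link[OF G] by blast
  next
    case False
    then show ?thesis using tournamentI_link[OF G] neg by blast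
  qed
qed

section \<open>Wreath products\<close>

text \<open>The vertex \<open>i + p a\<close> is position \<open>a\<close> in block \<open>i\<close>.  With this numbering, rather than with
  consecutive blocks, the wreath product of circulants is again a circulant: the shift moves block
  \<open>i\<close> to block \<open>i + 1\<close>, and passing from block \<open>p - 1\<close> to block \<open>0\<close> advances the position.\<close>

definition wreath :: "nat \<Rightarrow> nat pair_pre_digraph \<Rightarrow> nat pair_pre_digraph \<Rightarrow> nat pair_pre_digraph" where
  "wreath p G H = \<lparr>pverts = {..<p * p}, parcs = {(x, y). x < p * p \<and> y < p * p \<and>
     (if x mod p = y mod p then (x div p, y div p) \<in> parcs H else (x mod p, y mod p) \<in> parcs G)}\<rparr>"

lemma pverts_wreath [simp]: "pverts (wreath p G H) = {..<p * p}"
  by (simp add: wreath_def)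

lemma parcs_wreath: "(x, y) \<in> parcs (wreath p G H) \<longleftrightarrow> x < p * p \<and> y < p * p \<and>
     (if x mod p = y mod p then (x div p, y div p) \<in> parcs H else (x mod p, y mod p) \<in> parcs G)"
  by (simp add: wreath_def)

lemma div_less_block: "x < p * p \<Longrightarrow> x div p < (p::nat)"
  by (simp add: less_mult_imp_div_less)

lemma block_less: "i < p \<Longrightarrow> a < p \<Longrightarrow> i + p * a < p * (p::nat)"
proof -
  assume "i < p" "a < p"
  then have "i + p * a < p * Suc a" "p * Suc a \<le> p * p" by (simp, intro mult_le_mono) auto
  then show ?thesis by (rule less_le_trans)
qed

lemma wreath_circulant:
  assumes p: "p > 0" and G: "G \<in> circulants p" and H: "H \<in> circulants p"
  shows "wreath p G H \<in> circulants (p * p)"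
proof (intro iffD2[OF circulants_iff] conjI allI impI)
  fix u v
  show "u < p * p" "v < p * p" if "(u, v) \<in> parcs (wreath p G H)" using that by (simp_all add: parcs_wreath)
  show "u \<noteq> v" if "(u, v) \<in> parcs (wreath p G H)"
    using that circulant_arcD(3)[OF H, of "v div p" "v div p"] by (auto simp: parcs_wreath)
  assume u: "u < p * p" and v: "v < p * p"
  have m: "((w + 1) mod (p * p)) mod p = (w mod p + 1) mod p" for w
    by (simp add: mod_mod_cancel mod_simps)
  have d: "((w + 1) mod (p * p)) div p = (if (w mod p + 1) mod p = 0 then (w div p + 1) mod p else w div p)"
    if "w < p * p" for w
  proof -
    have "((w + 1) mod (p * p)) div p = ((w + 1) div p) mod p"
      using p by (simp add: mod_mult2_eq)
    moreover have "(w + 1) div p = (if (w mod p + 1) mod p = 0 then w div p + 1 else w div p)"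
      by (simp add: div_Suc mod_simps)
    ultimately show ?thesis using div_less_block[OF that] by simp
  qed
  have less: "(u + 1) mod (p * p) < p * p" "(v + 1) mod (p * p) < p * p" using p by simp_all
  show "(u, v) \<in> parcs (wreath p G H) \<longleftrightarrow> ((u + 1) mod (p * p), (v + 1) mod (p * p)) \<in> parcs (wreath p G H)"
  proof (cases "u mod p = v mod p")
    case True
    then have "((u + 1) mod (p * p)) mod p = ((v + 1) mod (p * p)) mod p" unfolding m by simp
    moreover have "(((u + 1) mod (p * p)) div p, ((v + 1) mod (p * p)) div p) \<in> parcs H \<longleftrightarrow>
        (u div p, v div p) \<in> parcs H"
      unfolding d[OF u] d[OF v] True
      using circulant_step[OF H div_less_block[OF u] div_less_block[OF v]] by simp
    ultimately show ?thesis unfolding parcs_wreath using u v less True by simp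
  next
    case False
    have "(u mod p + 1) mod p \<noteq> (v mod p + 1) mod p"
    proof
      assume "(u mod p + 1) mod p = (v mod p + 1) mod p"
      then have "u mod p mod p = v mod p mod p"
        using cong_add_rcancel_nat[of "u mod p" 1 "v mod p" p] unfolding cong_def by blast
      then show False using False by simp
    qed
    then show ?thesis
      unfolding parcs_wreath m using u v less False p circulant_step[OF G, of "u mod p" "v mod p"] by simp
  qed
qed (use p in simp_all)

lemma mod_div_eqI: "x mod p = y mod p \<Longrightarrow> x div p = y div p \<Longrightarrow> x = (y::nat)"
  by (metis mult_div_mod_eq)

lemma compl_wreath:
  assumes "pverts G = {..<p}" "pverts H = {..<p}"
  shows "compl_digraph (wreath p G H) = wreath p (compl_digraph G) (compl_digraph H)"
proof -
  have "parcs (compl_digraph (wreath p G H)) = parcs (wreath p (compl_digraph G) (compl_digraph H))"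
  proof (rule set_eqI, clarify)
    fix x y
    show "(x, y) \<in> parcs (compl_digraph (wreath p G H)) \<longleftrightarrow>
      (x, y) \<in> parcs (wreath p (compl_digraph G) (compl_digraph H))"
    proof (cases "x < p * p \<and> y < p * p")
      case True
      then have "p > 0" by (cases p) auto
      then have l: "x div p < p" "y div p < p" "x mod p < p" "y mod p < p"
        using True div_less_block by auto
      have "x = y \<longleftrightarrow> x mod p = y mod p \<and> x div p = y div p" using mod_div_eqI by blast
      then show ?thesis using True l by (cases "x mod p = y mod p") (simp_all add: compl_digraph_def parcs_wreath assms)
    next
      case False
      then show ?thesis by (simp add: compl_digraph_def parcs_wreath) blast
    qed
  qed
  then show ?thesis by (simp add: compl_digraph_def wreath_def)
qed

lemma wreath_isomorphic:
  assumes V: "pverts G = {..<p}" "pverts H = {..<p}" "pverts G' = {..<p}" "pverts H' = {..<p}"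
    and iso: "isomorphic G G'" "isomorphic H H'"
  shows "isomorphic (wreath p G H) (wreath p G' H')"
proof -
  obtain f where "isom f G G'" using iso(1) by (auto simp: isomorphic_def)
  then have f: "bij_betw f {..<p} {..<p}"
      "\<And>u v. u < p \<Longrightarrow> v < p \<Longrightarrow> (u, v) \<in> parcs G \<longleftrightarrow> (f u, f v) \<in> parcs G'"
    unfolding isom_def V by simp_all
  obtain g where "isom g H H'" using iso(2) by (auto simp: isomorphic_def)
  then have g: "bij_betw g {..<p} {..<p}"
      "\<And>u v. u < p \<Longrightarrow> v < p \<Longrightarrow> (u, v) \<in> parcs H \<longleftrightarrow> (g u, g v) \<in> parcs H'"
    unfolding isom_def V by simp_all
  define h where "h x = f (x mod p) + p * g (x div p)" for x
  have fl: "f i < p" and gl: "g i < p" if "i < p" for i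
    using that f(1) g(1) by (auto dest: bij_betwE)
  have fi: "f i = f j \<longleftrightarrow> i = j" and gi: "g i = g j \<longleftrightarrow> i = j" if "i < p" "j < p" for i j
    using that f(1) g(1) by (auto simp: bij_betw_def inj_on_def)
  have h: "h x < p * p" "h x mod p = f (x mod p)" "h x div p = g (x div p)"
    and xp: "x mod p < p" "x div p < p" if "x < p * p" for x
  proof -
    show xp: "x mod p < p" "x div p < p" using that div_less_block[OF that] by (auto intro: mod_less_divisor)
    show "h x < p * p" unfolding h_def using fl gl xp by (intro block_less) auto
    show "h x mod p = f (x mod p)" unfolding h_def using fl[OF xp(1)] by simp
    show "h x div p = g (x div p)" unfolding h_def using fl[OF xp(1)] by simp
  qed
  have "inj_on h {..<p * p}"
  proof (rule inj_onI)
    fix x y assume xy: "x \<in> {..<p * p}" "y \<in> {..<p * p}" "h x = h y"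
    then have l: "x < p * p" "y < p * p" by simp_all
    have "f (x mod p) = f (y mod p)" "g (x div p) = g (y div p)"
      using h(2,3)[OF l(1)] h(2,3)[OF l(2)] xy(3) by simp_all
    then have "x mod p = y mod p" "x div p = y div p"
      using fi[OF xp(1)[OF l(1)] xp(1)[OF l(2)]] gi[OF xp(2)[OF l(1)] xp(2)[OF l(2)]] by simp_all
    then show "x = y" by (rule mod_div_eqI)
  qed
  moreover have "h ` {..<p * p} \<subseteq> {..<p * p}" using h by auto
  ultimately have "bij_betw h {..<p * p} {..<p * p}"
    by (simp add: bij_betw_def endo_inj_surj)
  moreover have "(x, y) \<in> parcs (wreath p G H) \<longleftrightarrow> (h x, h y) \<in> parcs (wreath p G' H')"
    if "x < p * p" "y < p * p" for x y
    unfolding parcs_wreath using that h[OF that(1)] h[OF that(2)] xp[OF that(1)] xp[OF that(2)]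
      fi[of "x mod p" "y mod p"] f(2)[of "x mod p" "y mod p"] g(2)[of "x div p" "y div p"] by simp
  ultimately have "isom h (wreath p G H) (wreath p G' H')" unfolding isom_def by simp
  then show ?thesis unfolding isomorphic_def by blast
qed

lemma wreath_uniform:
  assumes "p > 0" shows "uniform p (wreath p G H)"
proof -
  have arc: "link (p * p) (wreath p G H) 0 d \<longleftrightarrow> (0, nat (d mod int p)) \<in> parcs G"
    if d: "\<not> int p dvd d" for d
  proof -
    define x where "x = nat (d mod int (p * p))"
    have xl: "x < p * p" unfolding x_def using assms by (simp add: nat_less_iff)
    have "int x mod int p = d mod int p"
      unfolding x_def using assms by (simp add: mod_mod_cancel)
    then have xm: "x mod p = nat (d mod int p)" by (metis nat_int zmod_int)
    have "d mod int p \<noteq> 0" using d by (simp add: dvd_eq_mod_eq_0)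
    moreover have "d mod int p \<ge> 0" using assms by simp
    ultimately have "x mod p \<noteq> 0" unfolding xm by linarith
    then show ?thesis unfolding link_def x_def[symmetric] parcs_wreath using xl xm assms by simp
  qed
  show ?thesis unfolding uniform_def
  proof (intro allI impI)
    fix d e assume "\<not> int p dvd d"
    then have "\<not> int p dvd d + int p * e" by (simp add: dvd_add_left_iff)
    then show "link (p * p) (wreath p G H) 0 (d + int p * e) = link (p * p) (wreath p G H) 0 d"
      using arc \<open>\<not> int p dvd d\<close> by simp
  qed
qed

lemma circulant_of_connection:
  assumes n: "n > 0" and Q: "\<And>d d'. [d = d'] (mod int n) \<Longrightarrow> Q d = Q d'" and Q0: "\<not> Q 0"
  shows "\<lparr>pverts = {..<n}, parcs = {(u, v). u < n \<and> v < n \<and> Q (int v - int u)}\<rparr> \<in> circulants n"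
proof (intro iffD2[OF circulants_iff[OF n]] conjI allI impI)
  fix u v assume "u < n" "v < n"
  have "[int ((v + 1) mod n) - int ((u + 1) mod n) = (int v + 1) - (int u + 1)] (mod int n)"
    by (intro cong_diff) (simp_all add: cong_def zmod_int add.commute)
  then have "Q (int ((v + 1) mod n) - int ((u + 1) mod n)) = Q (int v - int u)" using Q by simp
  then show "(u, v) \<in> parcs \<lparr>pverts = {..<n}, parcs = {(u, v). u < n \<and> v < n \<and> Q (int v - int u)}\<rparr> \<longleftrightarrow>
    ((u + 1) mod n, (v + 1) mod n) \<in>
      parcs \<lparr>pverts = {..<n}, parcs = {(u, v). u < n \<and> v < n \<and> Q (int v - int u)}\<rparr>"
    using \<open>u < n\<close> \<open>v < n\<close> n by simp
qed (use Q0 in auto)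

text \<open>The factors are read off the connection set: its residues prime to \<open>p\<close> describe the arcs
  between blocks, and its multiples of \<open>p\<close> those inside a block.\<close>

lemma uniform_imp_wreath:
  assumes p: "p > 0" and G: "G \<in> circulants (p * p)" and u: "uniform p G"
  shows "\<exists>A\<in>circulants p. \<exists>B\<in>circulants p. G = wreath p A B"
proof -
  let ?L = "link (p * p) G 0"
  define QA where "QA d \<longleftrightarrow> \<not> int p dvd d \<and> ?L d" for d
  define QB where "QB d \<longleftrightarrow> ?L (int p * d)" for d
  define A where "A = \<lparr>pverts = {..<p}, parcs = {(u, v). u < p \<and> v < p \<and> QA (int v - int u)}\<rparr>"
  define B where "B = \<lparr>pverts = {..<p}, parcs = {(u, v). u < p \<and> v < p \<and> QB (int v - int u)}\<rparr>"
  have QA: "QA d = QA d'" if "[d = d'] (mod int p)" for d d'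
  proof -
    have dv: "int p dvd d \<longleftrightarrow> int p dvd d'" using that by (rule cong_dvd_iff)
    obtain e where "d' = d + int p * e" using \<open>[d = d'] (mod int p)\<close> by (auto simp: cong_iff_lin)
    then show ?thesis using u dv unfolding QA_def uniform_def by metis
  qed
  have QB: "QB d = QB d'" if "[d = d'] (mod int p)" for d d'
  proof -
    have "[int p * d = int p * d'] (mod int (p * p))"
      using that unfolding cong_iff_dvd_diff by (simp flip: right_diff_distrib)
    then show ?thesis unfolding QB_def by (intro link_cong) auto
  qed
  have "A \<in> circulants p" unfolding A_def by (rule circulant_of_connection[where Q = QA, OF p QA]) (simp_all add: QA_def)
  moreover have "\<not> QB 0" unfolding QB_def using link_irrefl[OF G, of 0 0] by simp
  then have "B \<in> circulants p" unfolding B_def by (intro circulant_of_connection[where Q = QB, OF p QB])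
  moreover have "parcs G = parcs (wreath p A B)"
  proof (rule set_eqI, clarify)
    fix x y
    show "(x, y) \<in> parcs G \<longleftrightarrow> (x, y) \<in> parcs (wreath p A B)"
    proof (cases "x < p * p \<and> y < p * p")
      case True
      have arc: "(x, y) \<in> parcs G \<longleftrightarrow> ?L (int y - int x)" using True by (simp add: circulant_arc_iff[OF G])
      have xd: "int x = int p * int (x div p) + int (x mod p)"
        by (metis mult_div_mod_eq of_nat_add of_nat_mult)
      have yd: "int y = int p * int (y div p) + int (y mod p)"
        by (metis mult_div_mod_eq of_nat_add of_nat_mult)
      show ?thesis
      proof (cases "x mod p = y mod p")
        case m: True
        have "int y - int x = int p * (int (y div p) - int (x div p))"
          by (subst xd, subst yd) (simp only: m, simp add: algebra_simps)
        then have "?L (int y - int x) = QB (int (y div p) - int (x div p))" by (simp add: QB_def)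
        then show ?thesis
          unfolding parcs_wreath arc B_def using True m div_less_block[of x p] div_less_block[of y p] by simp
      next
        case m: False
        have e: "int y - int x = (int (y mod p) - int (x mod p)) + int p * (int (y div p) - int (x div p))"
          by (subst xd, subst yd) (simp add: algebra_simps)
        have nd: "\<not> int p dvd int (y mod p) - int (x mod p)"
        proof
          assume "int p dvd int (y mod p) - int (x mod p)"
          then have "[int (y mod p) = int (x mod p)] (mod int p)" by (simp only: cong_iff_dvd_diff)
          then have "[y mod p = x mod p] (mod p)" by (simp only: cong_int_iff)
          then show False using m by (simp add: cong_def)
        qed
        then have "?L (int y - int x) = ?L (int (y mod p) - int (x mod p))"
          unfolding e using u unfolding uniform_def by blast
        then have "?L (int y - int x) = QA (int (y mod p) - int (x mod p))" using nd by (simp add: QA_def)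
        then show ?thesis unfolding parcs_wreath arc A_def using True m p by simp
      qed
    next
      case False
      then show ?thesis using circulant_arcD(1,2)[OF G, of x y] by (auto simp: parcs_wreath)
    qed
  qed
  then have "G = wreath p A B" using circulant_pverts[OF G] by (simp add: wreath_def)
  ultimately show ?thesis by blast
qed

lemma wreath_symmetric_iff:
  assumes p: "p > 0" and G: "G \<in> circulants p" and H: "H \<in> circulants p"
  shows "symmetric (with_proj (wreath p G H)) \<longleftrightarrow> symmetric (with_proj G) \<and> symmetric (with_proj H)"
proof -
  have "sym (parcs (wreath p G H)) \<longleftrightarrow> sym (parcs G) \<and> sym (parcs H)"
  proof (intro iffI conjI)
    assume s: "sym (parcs (wreath p G H))"
    show "sym (parcs G)"
    proof (rule symI)
      fix i j assume ij: "(i, j) \<in> parcs G"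
      then have l: "i < p" "j < p" "i \<noteq> j" using circulant_arcD[OF G] by auto
      then have "i < p * p" "j < p * p" using block_less[of _ p 0] p by auto
      then have "(i, j) \<in> parcs (wreath p G H)" using ij l by (simp add: parcs_wreath)
      then have "(j, i) \<in> parcs (wreath p G H)" by (rule symD[OF s])
      then show "(j, i) \<in> parcs G" using l by (simp add: parcs_wreath)
    qed
    show "sym (parcs H)"
    proof (rule symI)
      fix a b assume ab: "(a, b) \<in> parcs H"
      then have "a < p" "b < p" using circulant_arcD[OF H] by auto
      then have "p * a < p * p" "p * b < p * p" by auto
      then have "(p * a, p * b) \<in> parcs (wreath p G H)" using ab p by (simp add: parcs_wreath)
      then have "(p * b, p * a) \<in> parcs (wreath p G H)" by (rule symD[OF s])
      then show "(b, a) \<in> parcs H" using p by (simp add: parcs_wreath)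
    qed
  next
    assume "sym (parcs G) \<and> sym (parcs H)"
    then show "sym (parcs (wreath p G H))"
      by (auto simp: sym_def parcs_wreath split: if_splits)
  qed
  then show ?thesis by (simp add: symmetric_def)
qed

lemma wreath_tournament_iff:
  assumes p: "p > 0" and G: "G \<in> circulants p" and H: "H \<in> circulants p"
  shows "tournament (wreath p G H) \<longleftrightarrow> tournament G \<and> tournament H"
proof -
  let ?T = "\<lambda>n G. \<forall>u<n. \<forall>v<n. u \<noteq> v \<longrightarrow> ((u, v) \<in> parcs G) \<noteq> ((v, u) \<in> parcs G)"
  have T: "tournament K \<longleftrightarrow> ?T n K" if "K \<in> circulants n" for K n
    using circulant_digraph[OF that] circulant_pverts[OF that] by (auto simp: tournament_def)
  have "?T (p * p) (wreath p G H) \<longleftrightarrow> ?T p G \<and> ?T p H"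
  proof (intro iffI conjI)
    assume t: "?T (p * p) (wreath p G H)"
    show "?T p G"
    proof (intro allI impI)
      fix i j assume l: "i < p" "j < p" "i \<noteq> j"
      then have "i < p * p" "j < p * p" using block_less[of _ p 0] p by auto
      then show "((i, j) \<in> parcs G) \<noteq> ((j, i) \<in> parcs G)"
        using t[rule_format, of i j] l by (simp add: parcs_wreath)
    qed
    show "?T p H"
    proof (intro allI impI)
      fix a b assume l: "a < p" "b < p" "a \<noteq> b"
      then have "p * a < p * p" "p * b < p * p" by auto
      then show "((a, b) \<in> parcs H) \<noteq> ((b, a) \<in> parcs H)"
        using t[rule_format, of "p * a" "p * b"] l p by (simp add: parcs_wreath)
    qed
  next
    assume t: "?T p G \<and> ?T p H"
    show "?T (p * p) (wreath p G H)"
    proof (intro allI impI)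
      fix x y assume xy: "x < p * p" "y < p * p" "x \<noteq> y"
      show "((x, y) \<in> parcs (wreath p G H)) \<noteq> ((y, x) \<in> parcs (wreath p G H))"
      proof (cases "x mod p = y mod p")
        case True
        then have "x div p \<noteq> y div p" using mod_div_eqI xy(3) by blast
        then have "((x div p, y div p) \<in> parcs H) \<noteq> ((y div p, x div p) \<in> parcs H)"
          using t[THEN conjunct2, rule_format] div_less_block xy by blast
        then show ?thesis using True xy by (simp add: parcs_wreath)
      next
        case False
        moreover have "x mod p < p" "y mod p < p" using p by simp_all
        ultimately have "((x mod p, y mod p) \<in> parcs G) \<noteq> ((y mod p, x mod p) \<in> parcs G)"
          using t[THEN conjunct1, rule_format] by blast
        then show ?thesis using False xy by (simp add: parcs_wreath)
      qed
    qed
  qed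
  then show ?thesis using T[OF G] T[OF H] T[OF wreath_circulant[OF p G H]] by blast
qed

section \<open>Valencies and recognition of blocks\<close>

definition outdeg :: "'a pair_pre_digraph \<Rightarrow> 'a \<Rightarrow> nat" where
  "outdeg G u = card {w \<in> pverts G. (u, w) \<in> parcs G}"

text \<open>An isomorphism invariant of pairs of vertices, which serves to recognise the blocks of a
  wreath product.\<close>

definition nbr_diff :: "'a pair_pre_digraph \<Rightarrow> 'a \<Rightarrow> 'a \<Rightarrow> nat" where
  "nbr_diff G u v = card {w \<in> pverts G. ((u, w) \<in> parcs G) \<noteq> ((v, w) \<in> parcs G)}"

lemma isom_arc:
  "isom f G H \<Longrightarrow> u \<in> pverts G \<Longrightarrow> v \<in> pverts G \<Longrightarrow> (f u, f v) \<in> parcs H \<longleftrightarrow> (u, v) \<in> parcs G"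
  unfolding isom_def by metis

lemma isom_card:
  assumes f: "isom f G H" and PQ: "\<And>w. w \<in> pverts G \<Longrightarrow> Q (f w) \<longleftrightarrow> P w"
  shows "card {w \<in> pverts H. Q w} = card {w \<in> pverts G. P w}"
proof -
  have b: "bij_betw f (pverts G) (pverts H)" using f by (simp add: isom_def)
  have "{w \<in> pverts H. Q w} = f ` {w \<in> pverts G. P w}"
  proof
    show "f ` {w \<in> pverts G. P w} \<subseteq> {w \<in> pverts H. Q w}"
      using PQ bij_betwE[OF b] by auto
    show "{w \<in> pverts H. Q w} \<subseteq> f ` {w \<in> pverts G. P w}"
    proof
      fix w assume w: "w \<in> {w \<in> pverts H. Q w}"
      then obtain x where "x \<in> pverts G" "w = f x" using b by (auto simp: bij_betw_def)
      then show "w \<in> f ` {w \<in> pverts G. P w}" using w PQ by blast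
    qed
  qed
  moreover have "inj_on f {w \<in> pverts G. P w}"
    using b by (auto simp: bij_betw_def intro: inj_on_subset)
  ultimately show ?thesis by (simp add: card_image)
qed

lemma isom_outdeg: "isom f G H \<Longrightarrow> u \<in> pverts G \<Longrightarrow> outdeg H (f u) = outdeg G u"
  unfolding outdeg_def by (rule isom_card[of f G H]) (simp_all add: isom_arc[of f G H])

lemma isom_nbr_diff:
  "isom f G H \<Longrightarrow> u \<in> pverts G \<Longrightarrow> v \<in> pverts G \<Longrightarrow> nbr_diff H (f u) (f v) = nbr_diff G u v"
  unfolding nbr_diff_def by (rule isom_card[of f G H]) (simp_all add: isom_arc[of f G H])

lemma rot_funpow_isom:
  assumes "n > 0" "G \<in> circulants n" shows "isom (rot n ^^ k) G G"
proof (induction k)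
  case 0 show ?case using isom_id by (simp add: id_def)
next
  case (Suc k) show ?case using isom_comp[OF Suc rot_isom[OF assms]] by (simp add: comp_def)
qed

lemma circulant_outdeg:
  assumes "G \<in> circulants n" "u < n" shows "outdeg G u = outdeg G 0"
proof -
  have n: "n > 0" using assms by simp
  have "outdeg G ((rot n ^^ u) 0) = outdeg G 0"
    using n by (intro isom_outdeg[OF rot_funpow_isom[OF n assms(1)]]) (simp add: circulant_pverts[OF assms(1)])
  then show ?thesis using assms(2) n by (simp add: rot_funpow)
qed

lemma outdeg_compl:
  assumes G: "G \<in> circulants n" and u: "u < n"
  shows "outdeg G u + outdeg (compl_digraph G) u + 1 = n"
proof -
  let ?N = "{w \<in> {..<n}. (u, w) \<in> parcs G}"
    and ?C = "{w \<in> {..<n}. (u, w) \<in> parcs (compl_digraph G)}"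
  have C: "?C = {..<n} - ?N - {u}"
    using u circulant_pverts[OF G] by (auto simp: compl_digraph_def)
  have un: "u \<notin> ?N" using circulant_arcD(3)[OF G, of u u] by auto
  have "card {..<n} = card ?N + card ({..<n} - ?N)"
  proof -
    have "card ?N \<le> card {..<n}" by (rule card_mono) auto
    then show ?thesis by (subst card_Diff_subset) auto
  qed
  moreover have "card ({..<n} - ?N) = Suc (card ?C)"
    unfolding C using u un by (subst card.remove[of _ u]) auto
  ultimately show ?thesis
    unfolding outdeg_def using circulant_pverts[OF G] by (simp add: compl_digraph_def)
qed

lemma outdeg_less: "G \<in> circulants n \<Longrightarrow> u < n \<Longrightarrow> outdeg G u < n"
  using outdeg_compl[of G n u] by linarith

lemma self_complementary_outdeg:
  assumes G: "G \<in> circulants n" and n: "n > 0" and sc: "isomorphic G (compl_digraph G)"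
  shows "2 * outdeg G 0 + 1 = n"
proof -
  obtain f where f: "isom f G (compl_digraph G)" using sc by (auto simp: isomorphic_def)
  note H = compl_circulant[OF n G]
  have "f 0 < n"
    using f n circulant_pverts[OF G] circulant_pverts[OF H] by (auto simp: isom_def dest: bij_betwE)
  then have "outdeg (compl_digraph G) 0 = outdeg G 0"
    using isom_outdeg[OF f, of 0] n circulant_pverts[OF G] circulant_outdeg[OF H, of "f 0"] by simp
  then show ?thesis using outdeg_compl[OF G n] by simp
qed

lemma card_blocks:
  fixes p :: nat
  assumes "p > 0"
  shows "card {w \<in> {..<p * p}. P (w mod p) (w div p)} = (\<Sum>i<p. card {a \<in> {..<p}. P i a})"
proof -
  let ?S = "SIGMA i:{..<p}. {a \<in> {..<p}. P i a}"
  have "bij_betw (\<lambda>w. (w mod p, w div p)) {w \<in> {..<p * p}. P (w mod p) (w div p)} ?S"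
    unfolding bij_betw_def
  proof
    show "inj_on (\<lambda>w. (w mod p, w div p)) {w \<in> {..<p * p}. P (w mod p) (w div p)}"
      by (rule inj_onI) (blast intro: mod_div_eqI)
    show "(\<lambda>w. (w mod p, w div p)) ` {w \<in> {..<p * p}. P (w mod p) (w div p)} = ?S" (is "?f ` ?W = _")
    proof
      show "?f ` ?W \<subseteq> ?S" using assms div_less_block by auto
      show "?S \<subseteq> ?f ` ?W"
      proof
        fix z assume "z \<in> ?S"
        then obtain i a where z: "z = (i, a)" "i < p" "a < p" "P i a" by auto
        then have w: "i + p * a \<in> ?W" and "z = ?f (i + p * a)" using block_less[of i p a] by auto
        then show "z \<in> ?f ` ?W" by (intro rev_image_eqI[OF w])
      qed
    qed
  qed
  then have "card {w \<in> {..<p * p}. P (w mod p) (w div p)} = card ?S" by (rule bij_betw_same_card)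
  also have "\<dots> = (\<Sum>i<p. card {a \<in> {..<p}. P i a})" by (rule card_SigmaI) simp_all
  finally show ?thesis .
qed

lemma wreath_outdeg:
  assumes p: "p > 0" and G: "G \<in> circulants p" and H: "H \<in> circulants p"
  shows "outdeg (wreath p G H) 0 = p * outdeg G 0 + outdeg H 0"
proof -
  let ?P = "\<lambda>i a. if i = 0 then (0, a) \<in> parcs H else (0, i) \<in> parcs G"
  have G0: "(0, 0) \<notin> parcs G" using circulant_arcD(3)[OF G, of 0 0] by auto
  have "outdeg (wreath p G H) 0 = card {w \<in> {..<p * p}. ?P (w mod p) (w div p)}"
    unfolding outdeg_def by (rule arg_cong[of _ _ card]) (use p in \<open>auto simp: parcs_wreath split: if_splits\<close>)
  also have "\<dots> = (\<Sum>i<p. card {a \<in> {..<p}. ?P i a})" by (rule card_blocks[OF p])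
  also have "\<dots> = (\<Sum>i<p. (if i = 0 then outdeg H 0 else 0) + (if (0, i) \<in> parcs G then p else 0))"
    by (rule sum.cong) (use G0 circulant_pverts[OF H] in \<open>auto simp: outdeg_def\<close>)
  also have "\<dots> = outdeg H 0 + (\<Sum>i<p. if (0, i) \<in> parcs G then p else 0)"
    using p by (simp add: sum.distrib)
  also have "(\<Sum>i<p. if (0, i) \<in> parcs G then p else 0) = p * outdeg G 0"
    by (simp add: outdeg_def circulant_pverts[OF G] sum.If_cases Int_def)
  finally show ?thesis by simp
qed

text \<open>Otherwise the connection set would be invariant under translation by \<open>i - j\<close>,
  a generator of \<open>\<int>\<^sub>p\<close>; it would contain \<open>0\<close> or be empty.\<close>

lemma circulant_prime_distinguishes:
  assumes p: "prime p" and G: "G \<in> circulants p" and ij: "i < p" "j < p" "i \<noteq> j"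
    and deg: "outdeg G 0 > 0"
  shows "\<exists>k<p. ((i, k) \<in> parcs G) \<noteq> ((j, k) \<in> parcs G)"
proof (rule ccontr)
  assume no: "\<not> (\<exists>k<p. ((i, k) \<in> parcs G) \<noteq> ((j, k) \<in> parcs G))"
  have p0: "p > 0" using ij by simp
  let ?L = "link p G 0"
  define e where "e = int i - int j"
  have e: "\<not> int p dvd e"
  proof
    assume "int p dvd e"
    then have "[int i = int j] (mod int p)" by (simp add: cong_iff_dvd_diff e_def)
    then have "[i = j] (mod p)" by (simp only: cong_int_iff)
    then show False using ij by (simp add: cong_def)
  qed
  have step: "?L (d + e) = ?L d" for d
  proof -
    define k where "k = nat ((d + int i) mod int p)"
    have k: "k < p" "[int k = d + int i] (mod int p)"
      using p0 by (simp_all add: k_def nat_less_iff cong_def)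
    have "?L d = ?L (int k - int i)"
      using cong_diff[OF k(2), of "int i" "int i"] by (intro link_cong) (auto simp: cong_sym_eq)
    also have "\<dots> = ((i, k) \<in> parcs G)" using circulant_arc_iff[OF G] ij k by simp
    also have "\<dots> = ((j, k) \<in> parcs G)" using no k by blast
    also have "\<dots> = ?L (int k - int j)" using circulant_arc_iff[OF G] ij k by simp
    also have "\<dots> = ?L (d + e)"
      using cong_diff[OF k(2), of "int j" "int j"] by (intro link_cong) (auto simp: e_def add_diff_eq)
    finally show ?thesis by simp
  qed
  have mult: "\<not> ?L (int m * e)" for m
  proof (induction m)
    case 0 show ?case using link_irrefl[OF G, of 0 0] by simp
  next
    case (Suc m) then show ?case using step[of "int m * e"] by (simp add: algebra_simps)
  qed
  have "{w \<in> pverts G. (0, w) \<in> parcs G} \<noteq> {}" using deg unfolding outdeg_def by (metis card.empty less_irrefl)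
  then obtain w where w: "(0, w) \<in> parcs G" by blast
  then have Lw: "?L (int w)" using circulant_arc_iff[OF G p0 circulant_arcD(2)[OF G w]] by simp
  have "coprime (int p) e" using e p by (intro prime_imp_coprime) simp_all
  then have "coprime e (int p)" by (simp add: coprime_commute)
  then obtain x where x: "[e * x = 1] (mod int p)" using cong_solve_coprime_int by blast
  define m where "m = nat ((x * int w) mod int p)"
  have "[int m = x * int w] (mod int p)" using p0 by (simp add: m_def cong_def)
  then have "[int m * e = x * int w * e] (mod int p)" by (rule cong_scalar_right)
  also have "x * int w * e = e * x * int w" by simp
  also have "[\<dots> = 1 * int w] (mod int p)" using x by (rule cong_scalar_right)
  finally have "?L (int m * e) = ?L (int w)" by (intro link_cong) auto
  then show False using mult Lw by blast
qed

text \<open>Let \<open>h = (p - 1) / 2\<close> be the valency of \<open>H\<close>.  Inside a block, at most \<open>2 h < p\<close> vertices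
  distinguish \<open>u\<close> from \<open>v\<close>.  For different blocks \<open>i\<close> and \<open>j\<close>, each of these two contributes \<open>h\<close> or
  \<open>h + 1\<close>.  Some block \<open>k\<close> is seen differently by \<open>i\<close> and \<open>j\<close> in \<open>G\<close>: if it is a third block, it
  contributes \<open>p\<close>; otherwise it contributes \<open>h + 1\<close>, and the total is at least \<open>2 h + 1 = p\<close>.\<close>

lemma nbr_diff_wreath_less_iff:
  assumes p: "prime p" and G: "G \<in> circulants p" and H: "H \<in> circulants p"
    and dG: "outdeg G 0 > 0" and dH: "2 * outdeg H 0 + 1 = p"
    and u: "u < p * p" and v: "v < p * p"
  shows "nbr_diff (wreath p G H) u v < p \<longleftrightarrow> u mod p = v mod p"
proof -
  have p0: "p > 0" using p prime_gt_0_nat by blast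
  define h where "h = outdeg H 0"
  define i j a b where "i = u mod p" and "j = v mod p" and "a = u div p" and "b = v div p"
  have ij: "i < p" "j < p" "a < p" "b < p"
    using p0 div_less_block u v by (simp_all add: i_def j_def a_def b_def)
  define P where "P k c = ((if i = k then (a, c) \<in> parcs H else (i, k) \<in> parcs G) \<noteq>
    (if j = k then (b, c) \<in> parcs H else (j, k) \<in> parcs G))" for k c
  define D where "D k = card {c \<in> {..<p}. P k c}" for k
  have "nbr_diff (wreath p G H) u v = card {w \<in> {..<p * p}. P (w mod p) (w div p)}"
    unfolding nbr_diff_def P_def using u v
    by (intro arg_cong[of _ _ card]) (auto simp: parcs_wreath i_def j_def a_def b_def)
  then have nd: "nbr_diff (wreath p G H) u v = (\<Sum>k<p. D k)"
    unfolding D_def using card_blocks[OF p0, of P] by simp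
  have nH: "card {c \<in> {..<p}. (x, c) \<in> parcs H} = h" if "x < p" for x
    using circulant_outdeg[OF H that] circulant_pverts[OF H] by (simp add: outdeg_def h_def)
  have nH': "card {c \<in> {..<p}. (x, c) \<notin> parcs H} = h + 1" if "x < p" for x
  proof -
    have "{c \<in> {..<p}. (x, c) \<notin> parcs H} = {..<p} - {c \<in> {..<p}. (x, c) \<in> parcs H}" by auto
    then have "card {c \<in> {..<p}. (x, c) \<notin> parcs H} = p - h"
      using nH[OF that] card_Diff_subset[of "{c \<in> {..<p}. (x, c) \<in> parcs H}" "{..<p}"] by auto
    then show ?thesis using dH h_def by simp
  qed
  show ?thesis
  proof (cases "i = j")
    case True
    have "D k = 0" if "k \<noteq> i" for k using that True by (simp add: D_def P_def)
    then have "(\<Sum>k<p. D k) = D i" using ij(1) by (subst sum.remove[of _ i]) auto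
    also have "D i \<le> card ({c \<in> {..<p}. (a, c) \<in> parcs H} \<union> {c \<in> {..<p}. (b, c) \<in> parcs H})"
      unfolding D_def P_def using True by (intro card_mono) auto
    also have "\<dots> \<le> h + h" using card_Un_le[of "{c \<in> {..<p}. (a, c) \<in> parcs H}" "{c \<in> {..<p}. (b, c) \<in> parcs H}"]
        nH[OF ij(3)] nH[OF ij(4)] by linarith
    also have "\<dots> < p" using dH h_def by simp
    finally show ?thesis using nd True by (simp add: i_def j_def)
  next
    case False
    have irr: "(k, k) \<notin> parcs G" for k using circulant_arcD(3)[OF G, of k k] by auto
    have Di: "D i = (if (j, i) \<in> parcs G then h + 1 else h)"
      unfolding D_def P_def using False nH[OF ij(3)] nH'[OF ij(3)] by simp
    have Dj: "D j = (if (i, j) \<in> parcs G then h + 1 else h)"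
      unfolding D_def P_def using False nH[OF ij(4)] nH'[OF ij(4)] by (simp add: eq_commute[of "_ \<in> parcs H"])
    obtain k where k: "k < p" "((i, k) \<in> parcs G) \<noteq> ((j, k) \<in> parcs G)"
      using circulant_prime_distinguishes[OF p G ij(1,2) False dG] by blast
    have "p \<le> (\<Sum>k<p. D k)"
    proof (cases "k = i \<or> k = j")
      case True
      then have "p \<le> D i + D j" using k irr Di Dj dH h_def by auto
      also have "\<dots> = (\<Sum>k\<in>{i, j}. D k)" using False by simp
      also have "\<dots> \<le> (\<Sum>k<p. D k)" using ij by (intro sum_mono2) auto
      finally show ?thesis .
    next
      case nk: False
      then have "D k = p" using k by (simp add: D_def P_def)
      then show ?thesis using member_le_sum[of k "{..<p}" D] k by simp
    qed
    then show ?thesis using nd False by (simp add: i_def j_def)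
  qed
qed

section \<open>Isomorphisms of wreath products\<close>

lemma wreath_isomorphicD:
  assumes p: "prime p" and c: "G \<in> circulants p" "H \<in> circulants p" "G' \<in> circulants p" "H' \<in> circulants p"
    and dG: "outdeg G 0 > 0" "outdeg G' 0 > 0"
    and dH: "2 * outdeg H 0 + 1 = p" "2 * outdeg H' 0 + 1 = p"
    and iso: "isomorphic (wreath p G H) (wreath p G' H')"
  shows "isomorphic G G'" "isomorphic H H'"
proof -
  let ?W = "wreath p G H" and ?W' = "wreath p G' H'"
  have p0: "p > 0" using p prime_gt_0_nat by blast
  obtain f where f: "isom f ?W ?W'" using iso by (auto simp: isomorphic_def)
  have fl: "f x < p * p" if "x < p * p" for x
    using f that by (auto simp: isom_def dest: bij_betwE)
  have inj: "x = y" if "f x = f y" "x < p * p" "y < p * p" for x y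
    using f that by (auto simp: isom_def bij_betw_def dest: inj_onD)
  have arc: "(f x, f y) \<in> parcs ?W' \<longleftrightarrow> (x, y) \<in> parcs ?W" if "x < p * p" "y < p * p" for x y
    using isom_arc[OF f, of x y] that by simp
  have block: "f x mod p = f y mod p \<longleftrightarrow> x mod p = y mod p" if "x < p * p" "y < p * p" for x y
    using nbr_diff_wreath_less_iff[OF p c(1,2) dG(1) dH(1) that]
      nbr_diff_wreath_less_iff[OF p c(3,4) dG(2) dH(2) fl[OF that(1)] fl[OF that(2)]]
      isom_nbr_diff[OF f, of x y] that by simp
  have bij: "bij_betw g {..<p} {..<p}"
    if "\<And>i. i < p \<Longrightarrow> g i < p" "\<And>i j. i < p \<Longrightarrow> j < p \<Longrightarrow> g i = g j \<Longrightarrow> i = j" for g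
  proof -
    have "inj_on g {..<p}" using that(2) by (intro inj_onI) simp
    moreover have "g ` {..<p} \<subseteq> {..<p}" using that(1) by auto
    ultimately show ?thesis by (simp add: bij_betw_def endo_inj_surj)
  qed
  have il: "i < p * p" if "i < p" for i using block_less[of i p 0] that p0 by simp
  have pl: "p * a < p * p" if "a < p" for a using that p0 by simp
  have "isom (\<lambda>i. f i mod p) G G'"
    unfolding isom_def circulant_pverts[OF c(1)] circulant_pverts[OF c(3)]
  proof (intro conjI ballI)
    show "bij_betw (\<lambda>i. f i mod p) {..<p} {..<p}"
    proof (rule bij)
      show "f i mod p < p" for i using p0 by simp
      show "i = j" if "i < p" "j < p" "f i mod p = f j mod p" for i j
        using block[OF il[OF that(1)] il[OF that(2)]] that by simp
    qed
    fix i j assume "i \<in> {..<p}" "j \<in> {..<p}"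
    then have ij: "i < p" "j < p" by auto
    show "(i, j) \<in> parcs G \<longleftrightarrow> (f i mod p, f j mod p) \<in> parcs G'"
    proof (cases "i = j")
      case True
      then show ?thesis using circulant_arcD(3)[OF c(1), of i j] circulant_arcD(3)[OF c(3), of "f i mod p" "f j mod p"]
        by auto
    next
      case False
      then have "(i, j) \<in> parcs G \<longleftrightarrow> (i, j) \<in> parcs ?W" using ij il by (simp add: parcs_wreath)
      also have "\<dots> \<longleftrightarrow> (f i, f j) \<in> parcs ?W'" using arc il ij by blast
      also have "\<dots> \<longleftrightarrow> (f i mod p, f j mod p) \<in> parcs G'"
        unfolding parcs_wreath
        using False ij block[OF il[OF ij(1)] il[OF ij(2)]] fl[OF il[OF ij(1)]] fl[OF il[OF ij(2)]] by simp
      finally show ?thesis .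
    qed
  qed
  then show "isomorphic G G'" unfolding isomorphic_def by blast
  have same: "f (p * a) mod p = f (p * b) mod p" if "a < p" "b < p" for a b
    using block[OF pl[OF that(1)] pl[OF that(2)]] by simp
  have "isom (\<lambda>a. f (p * a) div p) H H'"
    unfolding isom_def circulant_pverts[OF c(2)] circulant_pverts[OF c(4)]
  proof (intro conjI ballI)
    show "bij_betw (\<lambda>a. f (p * a) div p) {..<p} {..<p}"
    proof (rule bij)
      show "f (p * a) div p < p" if "a < p" for a using div_less_block[OF fl[OF pl[OF that]]] .
      show "a = b" if ab: "a < p" "b < p" "f (p * a) div p = f (p * b) div p" for a b
      proof -
        have "f (p * a) = f (p * b)" using mod_div_eqI[OF same[OF ab(1,2)] ab(3)] .
        then have "p * a = p * b" using inj pl ab by blast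
        then show ?thesis using p0 by simp
      qed
    qed
    fix a b assume "a \<in> {..<p}" "b \<in> {..<p}"
    then have ab: "a < p" "b < p" by auto
    have "(a, b) \<in> parcs H \<longleftrightarrow> (p * a, p * b) \<in> parcs ?W" using ab pl p0 by (simp add: parcs_wreath)
    also have "\<dots> \<longleftrightarrow> (f (p * a), f (p * b)) \<in> parcs ?W'" using arc[OF pl[OF ab(1)] pl[OF ab(2)]] by simp
    also have "\<dots> \<longleftrightarrow> (f (p * a) div p, f (p * b) div p) \<in> parcs H'"
      unfolding parcs_wreath using same[OF ab] fl[OF pl[OF ab(1)]] fl[OF pl[OF ab(2)]] by simp
    finally show "(a, b) \<in> parcs H \<longleftrightarrow> (f (p * a) div p, f (p * b) div p) \<in> parcs H'" .
  qed
  then show "isomorphic H H'" unfolding isomorphic_def by blast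
qed

text \<open>The invariant \<^const>\<open>nbr_diff\<close> transports the blocks to \<open>K\<close> as the classes of a
  translation invariant equivalence relation.  The class of \<open>0\<close> is closed under addition and has
  \<open>p\<close> elements, hence it is the unique subgroup of order \<open>p\<close>, the multiples of \<open>p\<close>.\<close>

lemma isomorphic_wreath_imp_uniform:
  assumes p: "prime p" and c: "G \<in> circulants p" "H \<in> circulants p" and K: "K \<in> circulants (p * p)"
    and dG: "outdeg G 0 > 0" and dH: "2 * outdeg H 0 + 1 = p"
    and iso: "isomorphic (wreath p G H) K"
  shows "uniform p K"
proof -
  let ?W = "wreath p G H"
  define n where "n = p * p"
  have p0: "p > 0" using p prime_gt_0_nat by blast
  have n0: "n > 0" using p0 by (simp add: n_def)
  note K = K[folded n_def]
  have VK: "pverts K = {..<n}" using circulant_pverts[OF K] .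
  obtain g where g: "isom g K ?W" using isomorphic_sym[OF iso] by (auto simp: isomorphic_def)
  have bij: "bij_betw g {..<n} {..<n}" using g VK by (simp add: isom_def n_def)
  have gl: "g x < n" if "x < n" for x using bij that by (auto dest: bij_betwE)
  define b where "b x = g x mod p" for x
  have close: "nbr_diff K x y < p \<longleftrightarrow> b x = b y" if "x < n" "y < n" for x y
    using nbr_diff_wreath_less_iff[OF p c dG dH, of "g x" "g y"] gl[OF that(1)] gl[OF that(2)]
      isom_nbr_diff[OF g, of x y] that VK by (simp add: b_def n_def)
  have shift: "b ((x + k) mod n) = b ((y + k) mod n) \<longleftrightarrow> b x = b y" if "x < n" "y < n" for x y k
  proof -
    have "nbr_diff K ((x + k) mod n) ((y + k) mod n) = nbr_diff K x y"
      using isom_nbr_diff[OF rot_funpow_isom[OF n0 K, of k], of x y] that VK by (simp add: rot_funpow)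
    moreover have "(x + k) mod n < n" "(y + k) mod n < n" using n0 by simp_all
    ultimately show ?thesis
      using close[OF that] close[of "(x + k) mod n" "(y + k) mod n"] by simp
  qed
  define M where "M = {x \<in> {..<n}. b x = b 0}"
  have cM: "card M = p"
  proof -
    have "card M = card {y \<in> {..<n}. y mod p = b 0}"
    proof (rule bij_betw_same_card)
      show "bij_betw g M {y \<in> {..<n}. y mod p = b 0}"
        using bij unfolding bij_betw_def M_def b_def
        by (auto intro: inj_on_subset simp: image_iff)
    qed
    also have "\<dots> = (\<Sum>i<p. card {a \<in> {..<p}. i = b 0})"
      unfolding n_def using card_blocks[OF p0, of "\<lambda>i a. i = b 0"] by simp
    also have "\<dots> = (\<Sum>i<p. if i = b 0 then p else 0)" by (rule sum.cong) auto
    also have "\<dots> = p" using p0 by (simp add: b_def)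
    finally show ?thesis .
  qed
  have add: "(x + y) mod n \<in> M" if "x \<in> M" "y \<in> M" for x y
    using shift[of y 0 x] that n0 by (simp add: M_def add.commute)
  have mult: "(m * x) mod n \<in> M" if "x \<in> M" for x m
  proof (induction m)
    case 0 then show ?case using n0 by (simp add: M_def)
  next
    case (Suc m) then show ?case using add[OF that Suc] by (simp add: mod_simps)
  qed
  have "M \<subseteq> {x \<in> {..<n}. x mod p = 0}"
  proof (rule subsetI, rule ccontr)
    fix x assume x: "x \<in> M" "x \<notin> {x \<in> {..<n}. x mod p = 0}"
    then have "\<not> p dvd x" by (auto simp: M_def)
    then have "coprime p x" using p by (rule prime_imp_coprime[rotated])
    then have "coprime x n" unfolding n_def by (simp add: coprime_commute)
    then obtain w where w: "[x * w = 1] (mod n)" using cong_solve_coprime_nat by auto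
    have "{..<n} \<subseteq> M"
    proof
      fix y assume y: "y \<in> {..<n}"
      have "[y * (x * w) = y * 1] (mod n)" using w by (rule cong_scalar_left)
      moreover have "y * (x * w) = y * w * x" by simp
      ultimately have "(y * w * x) mod n = y" using y by (simp add: cong_def)
      then show "y \<in> M" using mult[OF x(1), of "y * w"] by simp
    qed
    moreover have "finite M" by (simp add: M_def)
    ultimately have "n \<le> p" using cM card_mono[of M "{..<n}"] by simp
    then show False using prime_gt_1_nat[OF p] by (simp add: n_def)
  qed
  moreover have "card {x \<in> {..<n}. x mod p = 0} = p"
  proof -
    have "card {x \<in> {..<n}. x mod p = 0} = (\<Sum>i<p. card {a \<in> {..<p}. i = 0})"
      unfolding n_def using card_blocks[OF p0, of "\<lambda>i a. i = 0"] by simp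
    also have "\<dots> = (\<Sum>i<p. if i = 0 then p else 0)" by (rule sum.cong) auto
    also have "\<dots> = p" using p0 by simp
    finally show ?thesis .
  qed
  ultimately have M: "M = {x \<in> {..<n}. x mod p = 0}" using cM by (intro card_subset_eq) simp_all
  have block: "b x = b y" if xy: "x < n" "y < n" "x mod p = y mod p" for x y
  proof -
    \<comment> \<open>This is \<open>y - x\<close> modulo \<open>n\<close>, written without truncated subtraction.\<close>
    define z where "z = (y + (n - x)) mod n"
    have zl: "z < n" using n0 by (simp add: z_def)
    have "z mod p = (y + (n - x)) mod p" unfolding z_def n_def by (simp add: mod_mod_cancel)
    also have "\<dots> = (y mod p + (n - x)) mod p" by (simp add: mod_simps)
    also have "\<dots> = (x mod p + (n - x)) mod p" using xy by simp
    also have "\<dots> = (x + (n - x)) mod p" by (rule mod_add_left_eq)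
    also have "\<dots> = n mod p" using xy by simp
    also have "\<dots> = 0" by (simp add: n_def)
    finally have "z \<in> M" unfolding M using zl by simp
    then have "b z = b 0" by (simp add: M_def)
    then have "b ((z + x) mod n) = b ((0 + x) mod n)" using shift[OF zl n0] by simp
    moreover have "(z + x) mod n = y" using xy by (simp add: z_def mod_simps)
    ultimately show ?thesis using xy by simp
  qed
  have block0: "b x \<noteq> b 0" if "x < n" "x mod p \<noteq> 0" for x
  proof
    assume "b x = b 0"
    then have "x \<in> M" using that(1) by (simp add: M_def)
    then show False unfolding M using that(2) by simp
  qed
  have arc: "(0, x) \<in> parcs K \<longleftrightarrow> (b 0, b x) \<in> parcs G" if "x < n" "x mod p \<noteq> 0" for x
  proof -
    have "(0, x) \<in> parcs K \<longleftrightarrow> (g 0, g x) \<in> parcs ?W" using isom_arc[OF g, of 0 x] VK n0 that by simp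
    then show ?thesis
      unfolding parcs_wreath
      using gl[OF n0] gl[OF that(1)] block0[OF that] by (simp add: b_def n_def eq_commute[of "g 0 mod p"])
  qed
  show ?thesis
    unfolding uniform_def
  proof (intro allI impI)
    fix d e assume d: "\<not> int p dvd d"
    let ?x = "\<lambda>d. nat (d mod int n)"
    have xl: "?x d < n" for d using n0 by (simp add: nat_less_iff)
    have xm: "int (?x d mod p) = d mod int p" for d
      using n0 p0 by (simp add: zmod_int n_def mod_mod_cancel)
    have nz: "?x d mod p \<noteq> 0" if "\<not> int p dvd d" for d
    proof
      assume "?x d mod p = 0"
      then have "d mod int p = 0" using xm[of d] by simp
      then show False using that by (simp add: dvd_eq_mod_eq_0)
    qed
    have "int (?x (d + int p * e) mod p) = int (?x d mod p)" unfolding xm by simp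
    then have eq: "?x (d + int p * e) mod p = ?x d mod p" by (simp only: of_nat_eq_iff)
    have "link n K 0 (d + int p * e) = link n K 0 d"
      unfolding link_def using arc[OF xl nz[OF d]] arc[OF xl, of "d + int p * e"] nz[OF d] eq
        block[OF xl xl eq] by simp
    then show "link (p * p) K 0 (d + int p * e) = link (p * p) K 0 d" unfolding n_def .
  qed
qed

section \<open>Counting\<close>

text \<open>The number \<open>(p\<^sup>2 - 1) / 2\<close> has both digits equal to \<open>(p - 1) / 2\<close> in base \<open>p\<close>.\<close>

lemma half_digits:
  fixes a b p :: nat
  assumes "2 * (p * a + b) + 1 = p * p" "b < p"
  shows "2 * a + 1 = p" "2 * b + 1 = p"
proof -
  have "[2 * b + 1 + p * (2 * a) = 0] (mod p)"
    using assms(1) by (simp add: cong_0_iff algebra_simps)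
  then have "p dvd 2 * b + 1"
    by (metis cong_0_iff dvd_add_times_triv_right_iff mult.commute)
  then obtain k where k: "2 * b + 1 = p * k" by (elim dvdE)
  have "p * k < p * 2" using k assms(2) by linarith
  then have "k < 2" by simp
  then have "k = 1" using k by (cases k) auto
  then show b: "2 * b + 1 = p" using k by simp
  then have "p * (2 * a + 1) = p * p" using assms(1) by (simp add: algebra_simps)
  moreover have "p \<noteq> 0" using assms(2) by simp
  ultimately show "2 * a + 1 = p" by (metis mult_left_cancel)
qed

lemma card_classes_Un:
  assumes "finite S" "finite T" "\<And>G H. G \<in> S \<Longrightarrow> H \<in> T \<Longrightarrow> \<not> isomorphic G H"
  shows "card (iso_class ` (S \<union> T)) = card (iso_class ` S) + card (iso_class ` T)"
  unfolding image_Un using assms by (intro card_Un_disjoint) (auto simp: iso_class_eq_iff)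

lemma card_classes_prod:
  assumes "finite S" "\<And>G H G' H'. G \<in> S \<Longrightarrow> H \<in> S \<Longrightarrow> G' \<in> S \<Longrightarrow> H' \<in> S \<Longrightarrow>
    isomorphic (f G H) (f G' H') \<longleftrightarrow> isomorphic G G' \<and> isomorphic H H'"
  shows "card (iso_class ` (\<lambda>(G, H). f G H) ` (S \<times> S)) = (card (iso_class ` S))\<^sup>2"
proof -
  \<comment> \<open>The class of \<open>f G H\<close> as a function of the classes of \<open>G\<close> and \<open>H\<close>: the union is over one class only.\<close>
  let ?q = "\<lambda>C. \<Union> {iso_class (f G H) | G H. G \<in> S \<and> H \<in> S \<and> C = (iso_class G, iso_class H)}"
  have q: "?q (iso_class G, iso_class H) = iso_class (f G H)" if "G \<in> S" "H \<in> S" for G H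
  proof -
    have "iso_class (f G' H') = iso_class (f G H)"
      if "G' \<in> S" "H' \<in> S" "(iso_class G, iso_class H) = (iso_class G', iso_class H')" for G' H'
      using assms(2)[of G' H' G H] that \<open>G \<in> S\<close> \<open>H \<in> S\<close> by (auto simp: iso_class_eq_iff[symmetric])
    then have "{iso_class (f G' H') | G' H'. G' \<in> S \<and> H' \<in> S \<and>
        (iso_class G, iso_class H) = (iso_class G', iso_class H')} = {iso_class (f G H)}"
      using that by blast
    then show ?thesis by simp
  qed
  have "bij_betw ?q (iso_class ` S \<times> iso_class ` S) (iso_class ` (\<lambda>(G, H). f G H) ` (S \<times> S))"
    unfolding bij_betw_def
  proof
    show "inj_on ?q (iso_class ` S \<times> iso_class ` S)"
    proof (rule inj_onI)
      fix C D assume C: "C \<in> iso_class ` S \<times> iso_class ` S" and D: "D \<in> iso_class ` S \<times> iso_class ` S"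
        and eq: "?q C = ?q D"
      obtain G H where G: "G \<in> S" "H \<in> S" "C = (iso_class G, iso_class H)" using C by auto
      obtain G' H' where G': "G' \<in> S" "H' \<in> S" "D = (iso_class G', iso_class H')" using D by auto
      have "iso_class (f G H) = iso_class (f G' H')"
        using eq q[OF G(1,2)] q[OF G'(1,2)] unfolding G(3) G'(3) by metis
      then show "C = D"
        using assms(2)[OF G(1,2) G'(1,2)] G(3) G'(3) by (simp add: iso_class_eq_iff)
    qed
    show "?q ` (iso_class ` S \<times> iso_class ` S) = iso_class ` (\<lambda>(G, H). f G H) ` (S \<times> S)" (is "?l = ?r")
    proof
      show "?l \<subseteq> ?r"
      proof
        fix z assume "z \<in> ?l"
        then obtain G H where "G \<in> S" "H \<in> S" "z = ?q (iso_class G, iso_class H)" by blast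
        then show "z \<in> ?r" using q by auto
      qed
      show "?r \<subseteq> ?l"
      proof
        fix z assume "z \<in> ?r"
        then obtain G H where G: "G \<in> S" "H \<in> S" "z = iso_class (f G H)" by auto
        then have "z = ?q (iso_class G, iso_class H)" using q by simp
        then show "z \<in> ?l" using G by blast
      qed
    qed
  qed
  then have "card (iso_class ` (\<lambda>(G, H). f G H) ` (S \<times> S)) = card (iso_class ` S \<times> iso_class ` S)"
    by (rule bij_betw_same_card[symmetric])
  then show ?thesis by (simp add: card_cartesian_product power2_eq_square)
qed

text \<open>The map \<open>x \<mapsto> - x\<close> reverses all arcs, and reversal of a tournament is its complement.\<close>

lemma tournament_self_complementary:
  assumes n: "n > 0" and G: "G \<in> circulants n" and t: "tournament G"
  shows "isomorphic G (compl_digraph G)"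
proof -
  let ?f = "\<lambda>x. (n - x) mod n"
  have V: "pverts G = {..<n}" "pverts (compl_digraph G) = {..<n}"
    using circulant_pverts[OF G] by (simp_all add: compl_digraph_def)
  have fc: "[int (?f x) = - int x] (mod int n)" if "x < n" for x
    using that by (simp add: cong_def zmod_int of_nat_diff)
  have arc: "(?f u, ?f v) \<in> parcs G \<longleftrightarrow> (v, u) \<in> parcs G" if "u < n" "v < n" for u v
  proof -
    have "(?f u, ?f v) \<in> parcs G \<longleftrightarrow> link n G 0 (int (?f v) - int (?f u))"
      using n by (intro circulant_arc_iff[OF G]) simp_all
    also have "\<dots> \<longleftrightarrow> link n G 0 (- int v - - int u)"
      using cong_diff[OF fc[OF that(2)] fc[OF that(1)]] by (intro link_cong) auto
    also have "\<dots> \<longleftrightarrow> (v, u) \<in> parcs G" using circulant_arc_iff[OF G that(2,1)] by simp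
    finally show ?thesis .
  qed
  have inj: "u = v" if "u < n" "v < n" "?f u = ?f v" for u v
    using that by (cases "u = 0"; cases "v = 0") auto
  have "isom ?f G (compl_digraph G)"
    unfolding isom_def V
  proof (intro conjI ballI)
    have "inj_on ?f {..<n}" by (rule inj_onI, rule inj) simp_all
    moreover have "?f ` {..<n} \<subseteq> {..<n}" using n by auto
    ultimately show "bij_betw ?f {..<n} {..<n}" by (simp add: bij_betw_def endo_inj_surj)
    fix u v assume "u \<in> {..<n}" "v \<in> {..<n}"
    then have uv: "u < n" "v < n" by auto
    show "(u, v) \<in> parcs G \<longleftrightarrow> (?f u, ?f v) \<in> parcs (compl_digraph G)"
    proof (cases "u = v")
      case True
      then show ?thesis using circulant_arcD(3)[OF G, of u v] by (auto simp: compl_digraph_def)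
    next
      case False
      then have "?f u \<noteq> ?f v" using inj uv by blast
      moreover have "((u, v) \<in> parcs G) \<noteq> ((v, u) \<in> parcs G)"
        using t False uv V unfolding tournament_def by blast
      moreover have "?f u < n" "?f v < n" using n by simp_all
      ultimately show ?thesis using arc[OF uv] by (simp add: compl_digraph_def V)
    qed
  qed
  then show ?thesis unfolding isomorphic_def by blast
qed

lemma not_symmetric_tournament:
  assumes G: "G \<in> circulants n" and n: "n > 1" and s: "symmetric (with_proj G)"
  shows "\<not> tournament G"
proof
  assume "tournament G"
  then have t: "\<forall>u\<in>{..<n}. \<forall>v\<in>{..<n}. u \<noteq> v \<longrightarrow> ((u, v) \<in> parcs G) \<noteq> ((v, u) \<in> parcs G)"
    unfolding tournament_def circulant_pverts[OF G] by (rule conjunct2)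
  have "((0, 1) \<in> parcs G) \<noteq> ((1, 0) \<in> parcs G)"
    using t[rule_format, of 0 1] n by simp
  moreover have "sym (parcs G)" using s by (simp add: symmetric_def)
  ultimately show False by (metis symD)
qed

text \<open>Complementation commutes with wreath products.  The valency conditions of
  \<open>wreath_isomorphicD\<close> come from \<open>half_digits\<close>, since a self-complementary circulant of odd order
  \<open>n\<close> has valency \<open>(n - 1) / 2\<close>.\<close>

lemma self_complementary_wreath_iff:
  assumes p: "prime p" and G: "G \<in> circulants p" and H: "H \<in> circulants p"
  shows "isomorphic (wreath p G H) (compl_digraph (wreath p G H)) \<longleftrightarrow>
    isomorphic G (compl_digraph G) \<and> isomorphic H (compl_digraph H)" (is "?W \<longleftrightarrow> ?GH")
    and "isomorphic (wreath p G H) (compl_digraph (wreath p G H)) \<Longrightarrow> 2 * outdeg G 0 + 1 = p"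
    and "isomorphic (wreath p G H) (compl_digraph (wreath p G H)) \<Longrightarrow> 2 * outdeg H 0 + 1 = p"
proof -
  have p1: "p > 1" and p0: "p > 0" using p prime_gt_1_nat[OF p] by auto
  have pp: "p * p > 0" using p0 by simp
  note VG = circulant_pverts[OF G] and VH = circulant_pverts[OF H]
  note cG = compl_circulant[OF p0 G] and cH = compl_circulant[OF p0 H]
  have deg: "2 * outdeg G 0 + 1 = p" "2 * outdeg H 0 + 1 = p" if ?W
  proof -
    have "2 * (p * outdeg G 0 + outdeg H 0) + 1 = p * p"
      using self_complementary_outdeg[OF wreath_circulant[OF p0 G H] pp that]
      by (simp add: wreath_outdeg[OF p0 G H])
    from half_digits[OF this outdeg_less[OF H p0]]
    show "2 * outdeg G 0 + 1 = p" "2 * outdeg H 0 + 1 = p" .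
  qed
  then show "?W \<Longrightarrow> 2 * outdeg G 0 + 1 = p" "?W \<Longrightarrow> 2 * outdeg H 0 + 1 = p" by blast+
  show "?W \<longleftrightarrow> ?GH"
  proof
    assume W: ?W
    have dG: "outdeg G 0 > 0" using deg(1)[OF W] p1 by (cases "outdeg G 0") auto
    have cdG: "outdeg (compl_digraph G) 0 > 0" and cdH: "2 * outdeg (compl_digraph H) 0 + 1 = p"
      using deg[OF W] outdeg_compl[OF G p0] outdeg_compl[OF H p0] dG by linarith+
    from wreath_isomorphicD[OF p G H cG cH dG cdG deg(2)[OF W] cdH W[unfolded compl_wreath[OF VG VH]]]
    show ?GH by blast
  next
    assume GH: ?GH
    show ?W
      unfolding compl_wreath[OF VG VH]
      using GH VG VH by (intro wreath_isomorphic) (simp_all add: compl_digraph_def)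
  qed
qed

text \<open>Stated for arbitrary \<open>X\<close> and \<open>Y\<close> in order to serve self-complementary circulants,
  symmetric ones and tournaments alike.\<close>

lemma num_classes_uniform_split:
  assumes p: "prime p"
    and X: "X \<subseteq> {G \<in> circulants (p * p). isomorphic G (compl_digraph G)}"
    and Y: "Y \<subseteq> {G \<in> circulants p. isomorphic G (compl_digraph G)}"
    and XY: "\<And>G H. G \<in> circulants p \<Longrightarrow> H \<in> circulants p \<Longrightarrow> wreath p G H \<in> X \<longleftrightarrow> G \<in> Y \<and> H \<in> Y"
  shows "card (iso_class ` X) = (card (iso_class ` Y))\<^sup>2 + card (iso_class ` {G \<in> X. \<not> uniform p G})"
proof -
  have p1: "p > 1" and p0: "p > 0" using p prime_gt_1_nat[OF p] by auto
  have finX: "finite X" using finite_circulants[of "p * p"] X by (auto intro: finite_subset)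
  have finY: "finite Y" using finite_circulants[of p] Y by (auto intro: finite_subset)
  have Yc: "G \<in> circulants p" if "G \<in> Y" for G using that Y by blast
  have Yd: "2 * outdeg G 0 + 1 = p" if "G \<in> Y" for G
    using that Y self_complementary_outdeg[OF _ p0] by blast
  have Yd0: "outdeg G 0 > 0" if "G \<in> Y" for G using Yd[OF that] p1 by (cases "outdeg G 0") auto
  let ?U = "{G \<in> X. uniform p G}" and ?N = "{G \<in> X. \<not> uniform p G}"
  have U: "?U = (\<lambda>(G, H). wreath p G H) ` (Y \<times> Y)"
  proof
    show "(\<lambda>(G, H). wreath p G H) ` (Y \<times> Y) \<subseteq> ?U"
      using XY Yc wreath_uniform[OF p0] by auto
    show "?U \<subseteq> (\<lambda>(G, H). wreath p G H) ` (Y \<times> Y)"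
    proof
      fix K assume K: "K \<in> ?U"
      then obtain G H where GH: "G \<in> circulants p" "H \<in> circulants p" "K = wreath p G H"
        using uniform_imp_wreath[OF p0, of K] X by blast
      then have "(G, H) \<in> Y \<times> Y" using XY K by auto
      then show "K \<in> (\<lambda>(G, H). wreath p G H) ` (Y \<times> Y)" using GH(3) by auto
    qed
  qed
  have "card (iso_class ` ?U) = (card (iso_class ` Y))\<^sup>2"
    unfolding U
  proof (rule card_classes_prod[OF finY])
    fix G H G' H' assume m: "G \<in> Y" "H \<in> Y" "G' \<in> Y" "H' \<in> Y"
    show "isomorphic (wreath p G H) (wreath p G' H') \<longleftrightarrow> isomorphic G G' \<and> isomorphic H H'"
    proof
      assume "isomorphic (wreath p G H) (wreath p G' H')"
      from wreath_isomorphicD[OF p Yc[OF m(1)] Yc[OF m(2)] Yc[OF m(3)] Yc[OF m(4)]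
          Yd0[OF m(1)] Yd0[OF m(3)] Yd[OF m(2)] Yd[OF m(4)] this]
      show "isomorphic G G' \<and> isomorphic H H'" by blast
    next
      assume "isomorphic G G' \<and> isomorphic H H'"
      then show "isomorphic (wreath p G H) (wreath p G' H')"
        using circulant_pverts[OF Yc] m by (intro wreath_isomorphic) simp_all
    qed
  qed
  moreover have "card (iso_class ` (?U \<union> ?N)) = card (iso_class ` ?U) + card (iso_class ` ?N)"
  proof (rule card_classes_Un)
    fix K L assume K: "K \<in> ?U" and L: "L \<in> ?N"
    obtain G H where GH: "G \<in> Y" "H \<in> Y" "K = wreath p G H" using K unfolding U by auto
    have "L \<in> circulants (p * p)" using L X by blast
    then show "\<not> isomorphic K L"
      using isomorphic_wreath_imp_uniform[OF p Yc[OF GH(1)] Yc[OF GH(2)] _ Yd0[OF GH(1)] Yd[OF GH(2)], of L]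
        GH(3) L by blast
  qed (use finX in auto)
  moreover have "?U \<union> ?N = X" by blast
  ultimately show ?thesis by simp
qed

theorem mainTheorem7:
  fixes p :: nat
  assumes "prime p" and "odd p"
  shows "int (C_sd (p\<^sup>2)) - int (C_su (p\<^sup>2)) - int (C_t (p\<^sup>2)) =
         (int (C_sd p))\<^sup>2 - (int (C_su p))\<^sup>2 - (int (C_t p))\<^sup>2"
proof -
  have p1: "p > 1" and p0: "p > 0" using prime_gt_1_nat[OF assms(1)] by auto
  have pp0: "p * p > 0" and pp1: "p * p > 1" using p0 less_1_mult[OF p1 p1] by simp_all
  define sd where "sd n = {G \<in> circulants n. isomorphic G (compl_digraph G)}" for n
  define su where "su n = {G \<in> sd n. symmetric (with_proj G)}" for n
  define t where "t n = {G \<in> circulants n. tournament G}" for n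
  have t: "t n = {G \<in> sd n. tournament G}" if "n > 0" for n
    using tournament_self_complementary[OF that] by (auto simp: t_def sd_def)
  have num: "num_iso_classes S = card (iso_class ` S)" if "S \<subseteq> circulants n" for S n
    using circulant_wf that by (intro num_iso_classes_eq_card) blast
  have C: "C_sd n = card (iso_class ` sd n)" "C_su n = card (iso_class ` su n)"
    "C_t n = card (iso_class ` t n)" if "n > 0" for n
  proof -
    have "{G \<in> circulants n. self_complementary G} = sd n"
      using self_complementary_iff[OF that] by (auto simp: sd_def)
    then show "C_sd n = card (iso_class ` sd n)"
      unfolding C_sd_def using num[of "sd n" n] by (auto simp: sd_def)
    have "{G \<in> circulants n. self_complementary G \<and> symmetric (with_proj G)} = su n"
      using self_complementary_iff[OF that] by (auto simp: su_def sd_def)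
    then show "C_su n = card (iso_class ` su n)"
      unfolding C_su_def using num[of "su n" n] by (auto simp: su_def sd_def)
    show "C_t n = card (iso_class ` t n)"
      unfolding C_t_def t_def[symmetric] using num[of "t n" n] by (auto simp: t_def)
  qed
  let ?n = "p * p"
  let ?N = "\<lambda>X. {G \<in> X. \<not> uniform p G}"
  have wc: "wreath p G H \<in> circulants ?n" if "G \<in> circulants p" "H \<in> circulants p" for G H
    using wreath_circulant[OF p0 that] .
  have wsd: "wreath p G H \<in> sd ?n \<longleftrightarrow> G \<in> sd p \<and> H \<in> sd p"
    if "G \<in> circulants p" "H \<in> circulants p" for G H
    using self_complementary_wreath_iff(1)[OF assms(1) that] that wc[OF that] by (simp add: sd_def)
  have sd: "card (iso_class ` sd ?n) = (card (iso_class ` sd p))\<^sup>2 + card (iso_class ` ?N (sd ?n))"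
    by (rule num_classes_uniform_split[OF assms(1) _ _ wsd]) (auto simp: sd_def)
  have su: "card (iso_class ` su ?n) = (card (iso_class ` su p))\<^sup>2 + card (iso_class ` ?N (su ?n))"
  proof (rule num_classes_uniform_split[OF assms(1)])
    show "wreath p G H \<in> su ?n \<longleftrightarrow> G \<in> su p \<and> H \<in> su p"
      if "G \<in> circulants p" "H \<in> circulants p" for G H
      using wsd[OF that] wreath_symmetric_iff[OF p0 that] by (auto simp: su_def)
  qed (auto simp: su_def sd_def)
  have tt: "card (iso_class ` t ?n) = (card (iso_class ` t p))\<^sup>2 + card (iso_class ` ?N (t ?n))"
  proof (rule num_classes_uniform_split[OF assms(1)])
    show "wreath p G H \<in> t ?n \<longleftrightarrow> G \<in> t p \<and> H \<in> t p"
      if "G \<in> circulants p" "H \<in> circulants p" for G H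
      using wc[OF that] that wreath_tournament_iff[OF p0 that] by (auto simp: t_def)
  qed (auto simp: t[OF p0] t[OF pp0] sd_def)
  have "?N (sd ?n) = ?N (su ?n) \<union> ?N (t ?n)"
    unfolding t[OF pp0] su_def using symmetric_or_tournament[OF assms] by (auto simp: sd_def)
  moreover have "card (iso_class ` (?N (su ?n) \<union> ?N (t ?n))) =
      card (iso_class ` ?N (su ?n)) + card (iso_class ` ?N (t ?n))"
  proof (rule card_classes_Un)
    fix G H assume G: "G \<in> ?N (su ?n)" and H: "H \<in> ?N (t ?n)"
    have cH: "H \<in> circulants ?n" and tH: "tournament H" using H by (auto simp: t_def)
    have sG: "symmetric (with_proj G)" using G by (simp add: su_def)
    show "\<not> isomorphic G H"
      using isomorphic_symmetric[OF _ circulant_wf[OF cH] sG] not_symmetric_tournament[OF cH pp1] tH by blast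
  qed (auto intro: finite_subset[OF _ finite_circulants[of ?n]] simp: su_def sd_def t_def)
  ultimately have "card (iso_class ` ?N (sd ?n)) =
      card (iso_class ` ?N (su ?n)) + card (iso_class ` ?N (t ?n))" by simp
  then show ?thesis
    unfolding power2_eq_square[of p] C[OF p0] C[OF pp0] sd su tt by simp
qed

end
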